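(* (Suboptimality of the fixed point) In the off-policy setting described in the context, assume that the Markov chain induced by $\mu$ is ergodic, that $\pi(a|s)>0$ implies $\mu(a|s)>0$ for all $(s,a)$, and that the feature matrix $\boldsymbol\Phi$ has full column rank. Let $\mathbf w_\infty=\mathbf A^{-1}\mathbf b$ with $\mathbf A=\boldsymbol\Phi^\top\mathbf D_\mu^\theta(\mathbf I-(\mathbf P_\pi\boldsymbol\Gamma)^n)\boldsymbol\Phi$ and $\mathbf b=\boldsymbol\Phi^\top\mathbf D_\mu^\theta\mathbf r_\pi^n$. Then there exist positive constants $c_1,c_2,c_3$ such that $$\|\mathbf D_\mu^\epsilon\|\le c_1\ \Longrightarrow\ \|\boldsymbol\Phi\mathbf w_\infty-\mathbf v_\pi\|\le c_2\|\mathbf D_\mu^\epsilon\|+c_3\|\Pi_{\mathbf D_\mu^f}\mathbf v_\pi-\mathbf v_\pi\|_{\mathbf D_\mu^f}.$$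
   Context: **MDP.** $\mathcal S$ and $\mathcal A$ are finite state and action sets, $P(s'|s,a)$ is the transition probability, $r:\mathcal S\times\mathcal A\to\mathbb R$ is the reward function, $\gamma:\mathcal S\to[0,1]$ is a state-dependent discount, and $n\ge 1$ is a fixed integer. The target policy $\pi(a|s)$ and behavior policy $\mu(a|s)$ are fixed. Ergodic means irreducible and aperiodic; $d_\mu$ is the stationary distribution of the chain on $\mathcal S$ induced by $\mu$. **Value function.** $\mathbf v_\pi\in\mathbb R^{|\mathcal S|}$ is the vector with entries $v_\pi(s)=\mathbb E[G_t\mid S_t=s]$, where actions are drawn from $\pi$ from time $t$ on and $G_t=R_{t+1}+\gamma(S_{t+1})G_{t+1}$ is the discounted return with $R_{t+1}=r(S_t,A_t)$, i.e. $G_t=\sum_{i\ge t}\big(\prod_{j=t+1}^{i}\gamma(S_j)\big)R_{i+1}$. **Followon trace.** Along a trajectory with $A_t\sim\mu(\cdot|S_t)$, $S_{t+1}\sim P(\cdot|S_t,A_t)$, write $\rho_t=\pi(A_t|S_t)/\mu(A_t|S_t)$, $\gamma_t=\gamma(S_t)$, and set $F_0=\dots=F_{n-1}=1$, $F_t=\big(\prod_{i=t-n}^{t-1}\rho_i\gamma_{i+1}\big)F_{t-n}+1$ for $t\ge n$. It is a standing assumption that the (finite) limit $f(s)=\lim_{t\to\infty}\mathbb E_\mu[F_t\mid S_t=s]$ exists for every $s$. **Trace model and matrices.** $f_\theta:\mathcal S\to\mathbb R$ is a function with a fixed parameter $\theta$, approximating $f$. $\mathbf D_\mu^\theta$, $\mathbf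 D_\mu^f$ are the diagonal matrices with diagonal entries $d_\mu(s)f_\theta(s)$ and $d_\mu(s)f(s)$ respectively, and $\mathbf D_\mu^\epsilon=\mathbf D_\mu^\theta-\mathbf D_\mu^f$. $\mathbf P_\pi(s,s')=\sum_a\pi(a|s)P(s'|s,a)$, $\boldsymbol\Gamma=\mathrm{diag}(\gamma)$, $\mathbf r_\pi(s)=\sum_a\pi(a|s)r(s,a)$, $\mathbf r_\pi^n=\sum_{i=0}^{n-1}(\mathbf P_\pi\boldsymbol\Gamma)^i\mathbf r_\pi$. $\boldsymbol\phi(s)\in\mathbb R^K$ is the feature vector of $s$ and $\boldsymbol\Phi$ is the matrix whose $s$-th row is $\boldsymbol\phi(s)^\top$. **Norms and projection.** $\|\cdot\|$ is the Euclidean norm and the induced matrix norm; for a diagonal matrix $\mathbf D$ with positive diagonal, $\|x\|_{\mathbf D}=\sqrt{x^\top\mathbf D x}$ and $\Pi_{\mathbf D}$ is the $\|\cdot\|_{\mathbf D}$-orthogonal projection onto the column space of $\boldsymbol\Phi$. The constants $c_1,c_2,c_3$ do not depend on $f_\theta$ (the condition $\|\mathbf D_\mu^\epsilon\|\le c_1$ in particular makes $\mathbf A$ invertible, so that $\mathbf w_\infty$ is defined). *)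

theory Defs
  imports "HOL-Probability.Probability"
begin

section \<open>Matrices, norms and projections\<close>

(* The power operation of the type real^'s^'s is entrywise, hence a separate matrix power. *)
definition mat_pow :: "real^'s^'s \<Rightarrow> nat \<Rightarrow> real^'s^'s" where
  "mat_pow A k = ((**) A ^^ k) (mat 1)"

definition diag_mat :: "('s \<Rightarrow> real) \<Rightarrow> real^'s^'s" where
  "diag_mat d = (\<chi> i j. if i = j then d i else 0)"

definition matrix_norm :: "real^'m^'n \<Rightarrow> real" where
  "matrix_norm A = onorm ((*v) A)"

definition wnorm :: "real^'s^'s \<Rightarrow> real^'s \<Rightarrow> real" where
  "wnorm D x = sqrt (x \<bullet> (D *v x))"

definition col_space :: "real^'k^'s \<Rightarrow> (real^'s) set" where
  "col_space \<Phi> = span (columns \<Phi>)"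

(* Unique whenever D is diagonal with positive diagonal. *)
definition wproj :: "real^'s^'s \<Rightarrow> real^'k^'s \<Rightarrow> real^'s \<Rightarrow> real^'s" where
  "wproj D \<Phi> x =
     (THE y. y \<in> col_space \<Phi> \<and> (\<forall>z\<in>col_space \<Phi>. z \<bullet> (D *v (x - y)) = 0))"

definition feature_matrix :: "('s \<Rightarrow> real^'k) \<Rightarrow> real^'k^'s" where
  "feature_matrix \<phi> = (\<chi> s. \<phi> s)"

section \<open>Finite Markov chains\<close>

definition irreducible_chain :: "real^'s^'s \<Rightarrow> bool" where
  "irreducible_chain M \<longleftrightarrow> (\<forall>s s'. \<exists>k. 0 < mat_pow M k $ s $ s')"

definition aperiodic_chain :: "real^'s^'s \<Rightarrow> bool" where
  "aperiodic_chain M \<longleftrightarrow> (\<forall>s. Gcd {k. 0 < k \<and> 0 < mat_pow M k $ s $ s} = 1)"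

definition ergodic_chain :: "real^'s^'s \<Rightarrow> bool" where
  "ergodic_chain M \<longleftrightarrow> irreducible_chain M \<and> aperiodic_chain M"

definition stationary_distribution :: "real^'s^'s \<Rightarrow> 's pmf \<Rightarrow> bool" where
  "stationary_distribution M d \<longleftrightarrow> (\<chi> s. pmf d s) v* M = (\<chi> s. pmf d s)"

section \<open>Trajectories of a Markov decision process\<close>

(* A trajectory \<omega> consists of the pairs \<omega> t = (S t, A t). *)

definition init_pair :: "('s \<Rightarrow> 'a pmf) \<Rightarrow> 's pmf \<Rightarrow> ('s \<times> 'a) pmf" where
  "init_pair \<pi> d0 = bind_pmf d0 (\<lambda>s. map_pmf (Pair s) (\<pi> s))"

definition traj_kernel ::
  "('s \<Rightarrow> 'a \<Rightarrow> 's pmf) \<Rightarrow> ('s \<Rightarrow> 'a pmf) \<Rightarrow> 's pmf \<Rightarrow> nat \<Rightarrow> (nat \<Rightarrow> 's \<times> 'a) \<Rightarrow> ('s \<times> 'a) measure" where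
  "traj_kernel P \<pi> d0 t \<omega> = measure_pmf
     (case t of 0 \<Rightarrow> init_pair \<pi> d0
      | Suc u \<Rightarrow> init_pair \<pi> (P (fst (\<omega> u)) (snd (\<omega> u))))"

(* The law of the whole trajectory, by the Ionescu-Tulcea theorem. *)
definition traj_measure ::
  "('s \<Rightarrow> 'a \<Rightarrow> 's pmf) \<Rightarrow> ('s \<Rightarrow> 'a pmf) \<Rightarrow> 's pmf \<Rightarrow> (nat \<Rightarrow> 's \<times> 'a) measure" where
  "traj_measure P \<pi> d0 =
     projective_family.lim UNIV
       (Ionescu_Tulcea.CI (traj_kernel P \<pi> d0) (\<lambda>_. count_space UNIV)) (\<lambda>_. count_space UNIV)"

lemma PiM_discrete_measurable:
  fixes f :: "('i \<Rightarrow> 's::finite) \<Rightarrow> 'b"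
  assumes "finite I" "f \<in> (\<Pi>\<^sub>E i\<in>I. UNIV) \<rightarrow> space N"
  shows "f \<in> measurable (PiM I (\<lambda>_. count_space (UNIV :: 's set))) N"
proof -
  have fin: "finite (PiE I (\<lambda>_. UNIV :: 's set))"
    using assms(1) by (intro finite_PiE) auto
  have eq: "sets (PiM I (\<lambda>_. count_space (UNIV :: 's set))) = sets (count_space (PiE I (\<lambda>_. UNIV)))"
    using assms(1) fin by (subst count_space_PiM_finite) (auto simp: countable_finite)
  have "f \<in> measurable (count_space (PiE I (\<lambda>_. UNIV))) N"
    by (simp only: measurable_count_space_eq1 assms(2))
  then show ?thesis
    by (simp only: measurable_cong_sets[OF eq refl])
qed

lemma Ionescu_Tulcea_traj:
  fixes P :: "'s::finite \<Rightarrow> 'a::finite \<Rightarrow> 's pmf"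
  shows "Ionescu_Tulcea (traj_kernel P \<pi> d0) (\<lambda>_. count_space UNIV)"
proof (rule Ionescu_Tulcea.intro, goal_cases)
  case (1 i)
  show ?case
    unfolding traj_kernel_def
    by (intro PiM_discrete_measurable Pi_I measure_pmf_in_subprob_algebra finite_atLeastLessThan)
next
  case (2 i x)
  show ?case
    by (simp add: traj_kernel_def measure_pmf.prob_space_axioms)
qed

lemma pmf_init_pair: "pmf (init_pair \<pi> d0) (s, a) = pmf d0 s * pmf (\<pi> s) a"
  for d0 :: "'s::finite pmf" and \<pi> :: "'s \<Rightarrow> 'a::finite pmf"
proof -
  have *: "pmf (map_pmf (Pair s') (\<pi> s')) (s, a) = (if s' = s then pmf (\<pi> s) a else 0)" for s'
    by (auto simp: pmf_map_inj' inj_on_def intro: pmf_map_outside)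
  show ?thesis
    unfolding init_pair_def pmf_bind *
    by (subst integral_measure_pmf_real[where A=UNIV])
      (auto simp: if_distribR if_distrib[where f="\<lambda>x. x * _"] sum.delta cong: if_cong)
qed

(* The usual product formula for the finite-dimensional distributions. *)
lemma emeasure_traj_measure_cylinder:
  fixes P :: "'s::finite \<Rightarrow> 'a::finite \<Rightarrow> 's pmf"
  shows "emeasure (traj_measure P \<pi> d0) {\<omega>. \<forall>t\<le>m. \<omega> t = (s t, a t)} =
    ennreal (pmf d0 (s 0) * pmf (\<pi> (s 0)) (a 0) *
      (\<Prod>t<m. pmf (P (s t) (a t)) (s (Suc t)) * pmf (\<pi> (s (Suc t))) (a (Suc t))))"
proof -
  let ?M = "\<lambda>_::nat. count_space (UNIV :: ('s \<times> 'a) set)"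
  interpret IT: Ionescu_Tulcea "traj_kernel P \<pi> d0" ?M by (rule Ionescu_Tulcea_traj)
  define q where "q t = (s t, a t)" for t
  have single[measurable]: "{restrict q {0..<k}} \<in> sets (PiM {0..<k} ?M)" for k
  proof -
    have "{restrict q {0..<k}} = PiE {0..<k} (\<lambda>i. {q i})"
      by (rule PiE_singleton[symmetric, of "restrict q {0..<k}" "{0..<k}", simplified, THEN trans]) (auto intro!: PiE_cong)
    then show ?thesis by (auto intro!: sets_PiM_I_finite)
  qed
  have C: "emeasure (IT.C 0 k (\<lambda>_. undefined)) {restrict q {0..<k}} =
     (\<Prod>t<k. emeasure (traj_kernel P \<pi> d0 t q) {q t})" for k
  proof (induction k)
    case 0 show ?case using single[of 0] by (simp add: restrict_def)
  next
    case (Suc k)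
    have sp: "x \<in> space (PiM {0..<k} ?M)" if "x \<in> space (IT.C 0 k (\<lambda>_. undefined))" for x
      using that by (subst (asm) IT.space_C) (auto simp: space_PiM)
    have *: "emeasure (IT.eP k x) {restrict q {0..<Suc k}} =
       emeasure (traj_kernel P \<pi> d0 k q) {q k} * indicator {restrict q {0..<k}} x"
      if x: "x \<in> space (PiM {0..<k} ?M)" for x
    proof -
      have "emeasure (IT.eP k x) {restrict q {0..<Suc k}} =
         emeasure (traj_kernel P \<pi> d0 k x) {y. x(k := y) \<in> {restrict q {0..<Suc k}}}"
        using x IT.emeasure_eP[OF x single[of "Suc k"]]
        by (simp add: vimage_def traj_kernel_def)
      also have "{y. x(k := y) \<in> {restrict q {0..<Suc k}}} =
         (if x = restrict q {0..<k} then {q k} else {})"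
      proof -
        have "x(k := y) = restrict q {0..<Suc k} \<longleftrightarrow> x = restrict q {0..<k} \<and> y = q k" for y
        proof
          assume *: "x(k := y) = restrict q {0..<Suc k}"
          have "x j = restrict q {0..<k} j" for j
            using fun_cong[OF *, of j] x
            by (cases "j = k") (auto simp: space_PiM PiE_iff extensional_def restrict_def split: if_splits)
          with fun_cong[OF *, of k] show "x = restrict q {0..<k} \<and> y = q k"
            by auto
        qed (auto simp: fun_eq_iff restrict_def)
        then show ?thesis by auto
      qed
      also have "emeasure (traj_kernel P \<pi> d0 k x) \<dots> =
         emeasure (traj_kernel P \<pi> d0 k q) {q k} * indicator {restrict q {0..<k}} x"
        by (auto simp: traj_kernel_def split: nat.split)
      finally show ?thesis .
    qed
    have "emeasure (IT.C 0 (Suc k) (\<lambda>_. undefined)) {restrict q {0..<Suc k}} =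
      (\<integral>\<^sup>+x. emeasure (IT.eP k x) {restrict q {0..<Suc k}} \<partial>IT.C 0 k (\<lambda>_. undefined))"
    proof -
      have u: "(\<lambda>_. undefined) \<in> space (PiM {0..<0} ?M)" by (simp add: space_PiM)
      have "space (IT.C 0 k (\<lambda>_. undefined)) \<noteq> {}"
        using prob_space.not_empty[OF IT.prob_space_C[OF u]] .
      moreover have "IT.eP (0 + k) \<in> measurable (IT.C 0 k (\<lambda>_. undefined))
          (subprob_algebra (PiM {0..<Suc k} ?M))"
        using IT.measurable_eP[of k] IT.sets_C[OF u, of k]
        by (subst measurable_cong_sets[OF _ refl, of _ "PiM {0..<k} ?M"]) simp_all
      ultimately show ?thesis
        using emeasure_bind[OF _ _ single[of "Suc k"]] by (simp only: IT.C.simps add_0)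
    qed
    also have "\<dots> = (\<integral>\<^sup>+x. emeasure (traj_kernel P \<pi> d0 k q) {q k} * indicator {restrict q {0..<k}} x
        \<partial>IT.C 0 k (\<lambda>_. undefined))"
      by (intro nn_integral_cong * sp)
    also have "\<dots> = emeasure (traj_kernel P \<pi> d0 k q) {q k} *
        emeasure (IT.C 0 k (\<lambda>_. undefined)) {restrict q {0..<k}}"
      by (subst nn_integral_cmult_indicator) (auto simp: IT.sets_C space_PiM single[of k, simplified])
    finally show ?case unfolding Suc by (simp only: prod.lessThan_Suc mult.commute)
  qed
  have "{\<omega>. \<forall>t\<le>m. \<omega> t = (s t, a t)} = IT.PF.emb UNIV {0..<Suc m} {restrict q {0..<Suc m}}"
    by (auto simp: prod_emb_def space_PiM fun_eq_iff restrict_def less_Suc_eq_le q_def split: if_splits; metis)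
  then have "emeasure (traj_measure P \<pi> d0) {\<omega>. \<forall>t\<le>m. \<omega> t = (s t, a t)} =
      emeasure (IT.CI {0..<Suc m}) {restrict q {0..<Suc m}}"
    unfolding traj_measure_def by (simp only: IT.lim[OF _ single] finite_atLeastLessThan)
  also have "\<dots> = (\<Prod>t<Suc m. emeasure (traj_kernel P \<pi> d0 t q) {q t})"
    unfolding C[symmetric] using IT.emeasure_CI[OF order_refl single[of "Suc m"]]
    by (simp add: prod_emb_id)
  also have "\<dots> = emeasure (traj_kernel P \<pi> d0 0 q) {q 0} *
      (\<Prod>t<m. emeasure (traj_kernel P \<pi> d0 (Suc t) q) {q (Suc t)})"
    by (simp only: prod.lessThan_Suc_shift o_def)
  also have "\<dots> = ennreal (pmf d0 (s 0) * pmf (\<pi> (s 0)) (a 0) *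
      (\<Prod>t<m. pmf (P (s t) (a t)) (s (Suc t)) * pmf (\<pi> (s (Suc t))) (a (Suc t))))"
    by (simp add: traj_kernel_def emeasure_pmf_single q_def pmf_init_pair ennreal_mult prod_nonneg
        flip: prod_ennreal)
  finally show ?thesis .
qed

(* Conditional expectation given an event of positive probability. *)
definition cond_expect :: "'w measure \<Rightarrow> ('w \<Rightarrow> real) \<Rightarrow> 'w set \<Rightarrow> real" where
  "cond_expect M X E = (\<integral>\<omega>. X \<omega> \<partial>uniform_measure M E)"

section \<open>Policy evaluation\<close>

definition policy_matrix :: "('s::finite \<Rightarrow> 'a::finite \<Rightarrow> 's pmf) \<Rightarrow> ('s \<Rightarrow> 'a pmf) \<Rightarrow> real^'s^'s" where
  "policy_matrix P \<pi> = (\<chi> s s'. \<Sum>a\<in>UNIV. pmf (\<pi> s) a * pmf (P s a) s')"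

definition policy_reward :: "('s \<Rightarrow> 'a::finite \<Rightarrow> real) \<Rightarrow> ('s \<Rightarrow> 'a pmf) \<Rightarrow> real^'s" where
  "policy_reward r \<pi> = (\<chi> s. \<Sum>a\<in>UNIV. pmf (\<pi> s) a * r s a)"

definition discounted_matrix ::
  "('s::finite \<Rightarrow> 'a::finite \<Rightarrow> 's pmf) \<Rightarrow> ('s \<Rightarrow> real) \<Rightarrow> ('s \<Rightarrow> 'a pmf) \<Rightarrow> real^'s^'s" where
  "discounted_matrix P \<gamma> \<pi> = policy_matrix P \<pi> ** diag_mat \<gamma>"

definition nstep_reward ::
  "('s::finite \<Rightarrow> 'a::finite \<Rightarrow> 's pmf) \<Rightarrow> ('s \<Rightarrow> 'a \<Rightarrow> real) \<Rightarrow> ('s \<Rightarrow> real) \<Rightarrow> nat \<Rightarrow> ('s \<Rightarrow> 'a pmf) \<Rightarrow> real^'s" where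
  "nstep_reward P r \<gamma> n \<pi> =
     (\<Sum>i<n. mat_pow (discounted_matrix P \<gamma> \<pi>) i *v policy_reward r \<pi>)"

definition discounted_return ::
  "('s \<Rightarrow> 'a \<Rightarrow> real) \<Rightarrow> ('s \<Rightarrow> real) \<Rightarrow> nat \<Rightarrow> (nat \<Rightarrow> 's \<times> 'a) \<Rightarrow> real" where
  "discounted_return r \<gamma> t \<omega> =
     (\<Sum>k. (\<Prod>j\<in>{t+1..t+k}. \<gamma> (fst (\<omega> j))) * r (fst (\<omega> (t+k))) (snd (\<omega> (t+k))))"

(* By time-homogeneity it suffices to condition at time 0, i.e. to start the chain in s. *)
definition value_fun ::
  "('s::finite \<Rightarrow> 'a::finite \<Rightarrow> 's pmf) \<Rightarrow> ('s \<Rightarrow> 'a \<Rightarrow> real) \<Rightarrow> ('s \<Rightarrow> real) \<Rightarrow> ('s \<Rightarrow> 'a pmf) \<Rightarrow> real^'s" where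
  "value_fun P r \<gamma> \<pi> =
     (\<chi> s. \<integral>\<omega>. discounted_return r \<gamma> 0 \<omega> \<partial>traj_measure P \<pi> (return_pmf s))"

section \<open>Followon trace and fixed point\<close>

definition is_ratio :: "('s \<Rightarrow> 'a pmf) \<Rightarrow> ('s \<Rightarrow> 'a pmf) \<Rightarrow> 's \<times> 'a \<Rightarrow> real" where
  "is_ratio \<pi> \<mu> x = pmf (\<pi> (fst x)) (snd x) / pmf (\<mu> (fst x)) (snd x)"

(* The disjunct n = 0 only serves termination; n is at least 1 throughout. *)
function followon ::
  "('s \<Rightarrow> real) \<Rightarrow> nat \<Rightarrow> ('s \<Rightarrow> 'a pmf) \<Rightarrow> ('s \<Rightarrow> 'a pmf) \<Rightarrow> (nat \<Rightarrow> 's \<times> 'a) \<Rightarrow> nat \<Rightarrow> real" where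
  "followon \<gamma> n \<pi> \<mu> \<omega> t =
     (if n = 0 \<or> t < n then 1
      else (\<Prod>i\<in>{t-n..<t}. is_ratio \<pi> \<mu> (\<omega> i) * \<gamma> (fst (\<omega> (i+1)))) * followon \<gamma> n \<pi> \<mu> \<omega> (t-n) + 1)"
  by auto
termination by (relation "Wellfounded.measure (\<lambda>(\<gamma>, n, \<pi>, \<mu>, \<omega>, t). t)") auto

declare followon.simps [simp del]

(* E_mu[F_t | S_t = s] for a trajectory of the behaviour policy with initial distribution d0. *)
definition expected_followon ::
  "('s \<Rightarrow> 'a \<Rightarrow> 's pmf) \<Rightarrow> ('s \<Rightarrow> real) \<Rightarrow> nat \<Rightarrow> ('s \<Rightarrow> 'a pmf) \<Rightarrow> ('s \<Rightarrow> 'a pmf) \<Rightarrow> 's pmf \<Rightarrow> nat \<Rightarrow> 's \<Rightarrow> real" where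
  "expected_followon P \<gamma> n \<pi> \<mu> d0 t s =
     cond_expect (traj_measure P \<mu> d0) (\<lambda>\<omega>. followon \<gamma> n \<pi> \<mu> \<omega> t) {\<omega>. fst (\<omega> t) = s}"

definition weight_mat :: "'s pmf \<Rightarrow> ('s \<Rightarrow> real) \<Rightarrow> real^'s^'s" where
  "weight_mat d g = diag_mat (\<lambda>s. pmf d s * g s)"

definition td_matrix :: "real^'s^'s \<Rightarrow> real^'s^'s \<Rightarrow> nat \<Rightarrow> real^'k^'s \<Rightarrow> real^'k^'k" where
  "td_matrix D H n \<Phi> = transpose \<Phi> ** D ** (mat 1 - mat_pow H n) ** \<Phi>"

definition td_vector :: "real^'s^'s \<Rightarrow> real^'s \<Rightarrow> real^'k^'s \<Rightarrow> real^'k" where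
  "td_vector D b \<Phi> = transpose \<Phi> *v (D *v b)"

end

theory Submission
  imports Defs
begin

text \<open>Let H be the discounted matrix of \<pi>, G = H^n and x = d f. The masses m_t(s) = E[F_t 1{S_t = s}]
  satisfy m_(t+n) = m_t G + p_(t+n) with p_t the law of S_t; averaging over t and using that the Cesaro
  averages of p_t tend to d gives the emphasis equation x = x G + d. Hence x is a Lyapunov function
  for H, so the powers of H are summable and v satisfies (I - G) v = r^n, and D_f (I - G) is coercive
  with constant min d / 2. Coercivity survives a small perturbation of D_f, so A is invertible and
  \<Phi> w is a Galerkin approximation of v, for which the quasi-optimality estimate of Cea holds
  (even without the first-order term in the perturbation).\<close>

section \<open>Coercive matrices and Galerkin approximation\<close>

text \<open>The discount may equal 1, so \<open>H\<close> is only substochastic: no contraction is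
  available at the outset, \<open>mat 1 - H\<close> could be singular and the return could diverge.
  The decay has to be extracted from the existence of the finite limit \<open>f\<close>. The
  emphasis equation is the form in which it becomes usable: x G = x - d, and d is positive in every
  component by irreducibility, so each application of G loses a fixed fraction of x. The limit is
  taken over conditional expectations, which carry no information at times when the state has
  probability zero; the masses avoid dividing by such probabilities, and replacing the conditional
  expectation by \<open>f\<close> in them costs only p_t times a null sequence. The perturbation
  does no first-order harm because the same weight matrix multiplies both sides of the n-step
  Bellman equation, which v solves exactly. Changing the weights changes the test form of the
  Galerkin method, not the vector that is being approximated.\<close>

lemma mat_pow_0 [simp]: "mat_pow A 0 = mat 1"
  by (simp add: mat_pow_def)

lemma mat_pow_Suc: "mat_pow A (Suc k) = A ** mat_pow A k"
  by (simp add: mat_pow_def)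

lemma mat_pow_add: "mat_pow A (j + k) = mat_pow A j ** mat_pow A k"
  by (induction j) (simp_all add: mat_pow_Suc matrix_mul_assoc)

lemma mat_pow_Suc2: "mat_pow A (Suc k) = mat_pow A k ** A"
  using mat_pow_add[of A k 1] by (simp add: mat_pow_Suc)

lemma mat_pow_Suc_vec: "mat_pow A (Suc k) *v x = A *v (mat_pow A k *v x)"
  by (simp add: mat_pow_Suc matrix_vector_mul_assoc)

lemma mat_pow_Suc_vec2: "mat_pow A (Suc k) *v x = mat_pow A k *v (A *v x)"
  by (simp add: mat_pow_Suc2 matrix_vector_mul_assoc)

lemma diag_mat_vec [simp]: "(diag_mat d *v x) $ i = d i * x $ i"
  by (simp add: diag_mat_def matrix_vector_mult_def if_distrib[where f="\<lambda>y. y * _"] sum.delta cong: if_cong)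

lemma norm_mat_vec_le: "norm (A *v x) \<le> matrix_norm A * norm x"
  unfolding matrix_norm_def by (rule onorm) simp

lemma matrix_norm_nonneg: "0 \<le> matrix_norm A"
  unfolding matrix_norm_def by (rule onorm_pos_le) simp

text \<open>Adjointness, in the shape into which the simplifier brings
  \<open>transpose A *v y\<close>.\<close>

lemma inner_vector_matrix: "x \<bullet> (y v* A) = (A *v x) \<bullet> y"
  for A :: "real^'m^'n"
  by (metis dot_lmul_matrix inner_commute)

text \<open>The reduced matrix carries the bilinear form of \<open>K\<close> restricted to the
  column space. Statements about coefficient vectors are thereby read as statements about elements
  of that space.\<close>

lemma inner_congruence:
  "w \<bullet> ((transpose \<Phi> ** K ** \<Phi>) *v z) = (\<Phi> *v w) \<bullet> (K *v (\<Phi> *v z))"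
  for \<Phi> :: "real^'k^'s"
  by (simp add: matrix_vector_mul_assoc[symmetric] inner_vector_matrix)

text \<open>A kernel vector has an image of zero energy, which coercivity forces to vanish. Symmetry
  is not assumed, since the matrix \<open>D' ** B\<close> of the main proof is in general not
  symmetric.\<close>

lemma coercive_congruence_invertible:
  fixes \<Phi> :: "real^'k^'s"
  assumes inj: "inj ((*v) \<Phi>)" and c: "0 < c" "\<And>y. c * (norm y)\<^sup>2 \<le> y \<bullet> (K *v y)"
  shows "invertible (transpose \<Phi> ** K ** \<Phi>)"
proof -
  have "w = 0" if "(transpose \<Phi> ** K ** \<Phi>) *v w = 0" for w
  proof -
    have "c * (norm (\<Phi> *v w))\<^sup>2 \<le> 0"
      using c(2)[of "\<Phi> *v w"] inner_congruence[of w \<Phi> K w] that by simp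
    then have "\<Phi> *v w = 0"
      using c(1) by (simp add: mult_le_0_iff)
    then show "w = 0"
      using injD[OF inj, of w 0] by simp
  qed
  then show ?thesis
    by (simp add: invertible_left_inverse matrix_left_invertible_ker)
qed

lemma matrix_inv_vec:
  fixes A :: "real^'n^'n"
  assumes "invertible A"
  shows "A *v (matrix_inv A *v b) = b"
proof -
  have "A ** matrix_inv A = mat 1"
    using someI_ex[OF assms[unfolded invertible_def]] by (simp add: matrix_inv_def)
  then show ?thesis by (simp add: matrix_vector_mul_assoc)
qed

lemma range_matrix_vector: "range ((*v) \<Phi>) = col_space \<Phi>"
  for \<Phi> :: "real^'k^'s"
  unfolding col_space_def
proof (intro equalityI subsetI)
  fix x assume "x \<in> range ((*v) \<Phi>)"
  then show "x \<in> span (columns \<Phi>)"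
    using matrix_vector_mult_in_columnspace by blast
next
  fix x assume "x \<in> span (columns \<Phi>)"
  moreover have "subspace (range ((*v) \<Phi>))"
    by (intro linear_subspace_image) auto
  moreover have "columns \<Phi> \<subseteq> range ((*v) \<Phi>)"
    by (auto simp: columns_image_basis)
  ultimately show "x \<in> range ((*v) \<Phi>)"
    using span_minimal by blast
qed

text \<open>\<open>wproj\<close> is a definite description, so nothing follows about it before
  existence and uniqueness are established. Existence comes from the normal equations, uniqueness
  from coercivity of \<open>D\<close>.\<close>

lemma wproj_in_col_space:
  fixes \<Phi> :: "real^'k^'s"
  assumes inj: "inj ((*v) \<Phi>)" and c: "0 < c" "\<And>y. c * (norm y)\<^sup>2 \<le> y \<bullet> (D *v y)"
  shows "wproj D \<Phi> x \<in> col_space \<Phi>"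
proof -
  let ?A = "transpose \<Phi> ** D ** \<Phi>"
  let ?Q = "\<lambda>y. y \<in> col_space \<Phi> \<and> (\<forall>z\<in>col_space \<Phi>. z \<bullet> (D *v (x - y)) = 0)"
  \<comment> \<open>The coefficient vector of the projection, as solution of the normal
    equations.\<close>
  define w where "w = matrix_inv ?A *v (transpose \<Phi> *v (D *v x))"
  have eq: "?A *v w = transpose \<Phi> *v (D *v x)"
    unfolding w_def by (rule matrix_inv_vec[OF coercive_congruence_invertible[OF inj c]])
  have "(\<Phi> *v u) \<bullet> (D *v (x - \<Phi> *v w)) = 0" for u
    using inner_congruence[of u \<Phi> D w]
    by (simp add: eq inner_vector_matrix matrix_vector_mult_diff_distrib inner_diff_right)
  then have ex: "?Q (\<Phi> *v w)"
    by (auto simp: range_matrix_vector[symmetric])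
  have "y = y'" if "?Q y" "?Q y'" for y y'
  proof -
    have "y - y' \<in> col_space \<Phi>"
      using that by (auto simp: col_space_def intro: span_diff)
    \<comment> \<open>Both orthogonality relations are tested with the difference of the two
      candidates; subtracting them eliminates \<open>x\<close>.\<close>
    then have "(y - y') \<bullet> (D *v (x - y')) - (y - y') \<bullet> (D *v (x - y)) = 0"
      using that by simp
    then have "(y - y') \<bullet> (D *v (y - y')) = 0"
      by (simp add: matrix_vector_mult_diff_distrib inner_diff_right inner_diff_left)
    then have "c * (norm (y - y'))\<^sup>2 \<le> 0"
      using c(2)[of "y - y'"] by simp
    then show ?thesis
      using c(1) by (simp add: mult_le_0_iff)
  qed
  with ex have "\<exists>!y. ?Q y" by blast
  from theI'[OF this] show ?thesis
    unfolding wproj_def by blast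
qed

text \<open>Galerkin orthogonality lets v replace the discrete solution when testing within the
  column space. The part \<open>e\<close> of the error lying in that space then has energy at most C
  |e| |v - p|, coercivity bounds it below by c |e|^2, and the triangle inequality contributes the
  summand 1.\<close>

lemma Cea:
  fixes \<Phi> :: "real^'k^'s"
  assumes c: "0 < c" "\<And>y. c * (norm y)\<^sup>2 \<le> y \<bullet> (K *v y)"
    and C: "\<And>y. norm (K *v y) \<le> C * norm y"
    and galerkin: "(transpose \<Phi> ** K ** \<Phi>) *v w = transpose \<Phi> *v (K *v v)"
    and p: "p \<in> col_space \<Phi>"
  shows "norm (\<Phi> *v w - v) \<le> (1 + C / c) * norm (p - v)"
proof -
  obtain u where u: "p = \<Phi> *v u"
    using p by (auto simp: range_matrix_vector[symmetric])
  define e where "e = \<Phi> *v w - p"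
  have e: "e = \<Phi> *v (w - u)"
    by (simp add: e_def u matrix_vector_mult_diff_distrib)
  have "e \<bullet> (K *v (\<Phi> *v w)) = e \<bullet> (K *v v)"
    unfolding e using inner_congruence[of "w - u" \<Phi> K w] by (simp add: galerkin inner_vector_matrix)
  then have "e \<bullet> (K *v e) = e \<bullet> (K *v (v - p))"
    by (simp add: e_def matrix_vector_mult_diff_distrib inner_diff_right)
  then have "c * (norm e)\<^sup>2 \<le> norm e * norm (K *v (v - p))"
    using c(2)[of e] norm_cauchy_schwarz[of e "K *v (v - p)"] by linarith
  also have "\<dots> \<le> norm e * (C * norm (v - p))"
    by (intro mult_left_mono C) auto
  finally have "norm e * (c * norm e) \<le> norm e * (C * norm (v - p))"
    by (simp add: power2_eq_square mult_ac)
  \<comment> \<open>The sign of \<open>C\<close> is only known through its bound; this settles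
    \<open>e = 0\<close>, where the factor \<open>norm e\<close> cannot be cancelled.\<close>
  moreover have "0 \<le> C * norm (v - p)"
    using C norm_ge_zero order_trans by metis
  ultimately have "c * norm e \<le> C * norm (v - p)"
    by (cases "e = 0") simp_all
  then have "norm e \<le> C / c * norm (p - v)"
    using c(1) by (simp add: field_simps norm_minus_commute)
  moreover have "norm (\<Phi> *v w - v) \<le> norm e + norm (p - v)"
    using norm_triangle_ineq[of e "p - v"] by (simp add: e_def)
  ultimately show ?thesis by (simp add: algebra_simps)
qed

section \<open>Irreducible chains\<close>

lemma cesaro_null:
  fixes x :: "nat \<Rightarrow> real"
  assumes "x \<longlonglongrightarrow> 0"
  shows "(\<lambda>T. (\<Sum>t<Suc T. x t) / real (Suc T)) \<longlonglongrightarrow> 0"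
proof (rule LIMSEQ_I)
  fix e :: real assume e: "0 < e"
  obtain N where N: "\<And>t. t \<ge> N \<Longrightarrow> \<bar>x t\<bar> < e / 2"
    using LIMSEQ_D[OF assms, of "e / 2"] e by auto
  define C where "C = (\<Sum>t<N. \<bar>x t\<bar>)"
  \<comment> \<open>From \<open>T0\<close> on, the fixed head \<open>C\<close> contributes less than
    e/2 to the average.\<close>
  obtain T0 :: nat where T0: "2 * C / e < real T0"
    using reals_Archimedean2 by blast
  have "norm ((\<Sum>t<Suc T. x t) / real (Suc T) - 0) < e" if T: "T \<ge> max N T0" for T
  proof -
    have "\<bar>\<Sum>t<Suc T. x t\<bar> \<le> (\<Sum>t<Suc T. \<bar>x t\<bar>)"
      by (rule sum_abs)
    also have "\<dots> = C + (\<Sum>t\<in>{N..<Suc T}. \<bar>x t\<bar>)"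
      unfolding C_def using T
      by (subst sum.union_disjoint[symmetric])
        (auto simp del: sum.lessThan_Suc intro!: arg_cong[where f="sum _"])
    also have "(\<Sum>t\<in>{N..<Suc T}. \<bar>x t\<bar>) \<le> (\<Sum>t\<in>{N..<Suc T}. e / 2)"
      using N by (intro sum_mono) (auto intro: less_imp_le)
    also have "\<dots> \<le> real (Suc T) * (e / 2)"
      using e by (simp add: mult_right_mono)
    finally have "\<bar>\<Sum>t<Suc T. x t\<bar> \<le> C + real (Suc T) * (e / 2)" by simp
    moreover have "C < real (Suc T) * (e / 2)"
    proof -
      have "2 * C / e < real (Suc T)" using T0 T by linarith
      then show ?thesis using e by (simp add: field_simps)
    qed
    ultimately have "\<bar>\<Sum>t<Suc T. x t\<bar> < real (Suc T) * e"
      by (simp add: field_simps)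
    then show ?thesis by (simp add: field_simps abs_divide)
  qed
  then show "\<exists>no. \<forall>n\<ge>no. norm ((\<Sum>t<Suc n. x t) / real (Suc n) - 0) < e" by blast
qed

section \<open>Nonnegative matrices and their stationary vectors\<close>

lemma mat_pow_nonneg:
  fixes M :: "real^'s^'s"
  assumes "\<And>s s'. 0 \<le> M $ s $ s'"
  shows "0 \<le> mat_pow M k $ s $ s'"
proof (induction k arbitrary: s)
  case 0 show ?case by (simp add: mat_def)
next
  case (Suc k) then show ?case
    by (auto simp: mat_pow_Suc matrix_matrix_mult_def assms intro!: sum_nonneg)
qed

lemma stationary_mat_pow: "x v* M = x \<Longrightarrow> x v* mat_pow M k = x"
  by (induction k) (simp_all add: mat_pow_Suc vector_matrix_mul_assoc[symmetric])

text \<open>A zero propagates backwards: \<open>x $ s\<close> is a sum of nonnegative terms over all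
  states that reach \<open>s\<close> in k steps, and by irreducibility every state does so for some
  k.\<close>

lemma irreducible_stationary_zero:
  fixes M :: "real^'s^'s"
  assumes M: "\<And>s s'. 0 \<le> M $ s $ s'" and irr: "irreducible_chain M"
    and x: "x v* M = x" "\<And>s. 0 \<le> x $ s" and zero: "x $ s = 0"
  shows "x = 0"
proof -
  have "x $ s' = 0" for s'
  proof -
    obtain k where k: "0 < mat_pow M k $ s' $ s"
      using irr by (auto simp: irreducible_chain_def)
    have "(\<Sum>i\<in>UNIV. mat_pow M k $ i $ s * x $ i) = 0"
      using arg_cong[OF stationary_mat_pow[OF x(1), of k], of "\<lambda>v. v $ s"] zero
      by (simp add: vector_matrix_mult_def mult.commute)
    then have "\<forall>i. mat_pow M k $ i $ s * x $ i = 0"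
      using mat_pow_nonneg[OF M] x(2) by (subst (asm) sum_nonneg_eq_0_iff) auto
    then show ?thesis using k by (metis less_irrefl mult_eq_0_iff)
  qed
  then show ?thesis by (simp add: vec_eq_iff)
qed

lemma irreducible_stationary_pos:
  fixes M :: "real^'s^'s"
  assumes "\<And>s s'. 0 \<le> M $ s $ s'" "irreducible_chain M" "x v* M = x" "\<And>s. 0 \<le> x $ s" "x \<noteq> 0"
  shows "0 < x $ s"
  using irreducible_stationary_zero[of M x s] assms by (metis less_eq_real_def)

text \<open>Subtract from \<open>x\<close> the largest multiple of \<open>y\<close> that keeps the
  difference nonnegative. The difference is stationary and touches zero, hence vanishes, and the
  normalisation makes the multiple 1.\<close>

lemma irreducible_stationary_unique:
  fixes M :: "real^'s^'s"
  assumes M: "\<And>s s'. 0 \<le> M $ s $ s'" and irr: "irreducible_chain M"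
    and x: "x v* M = x" "\<And>s. 0 \<le> x $ s" "(\<Sum>s\<in>UNIV. x $ s) = 1"
    and y: "y v* M = y" "\<And>s. 0 \<le> y $ s" "(\<Sum>s\<in>UNIV. y $ s) = 1"
  shows "x = y"
proof -
  have "y \<noteq> 0" using y(3) by auto
  then have ypos: "0 < y $ s" for s
    using irreducible_stationary_pos[OF M irr y(1,2)] by blast
  define c where "c = Min (range (\<lambda>s. x $ s / y $ s))"
  have "c \<in> range (\<lambda>s. x $ s / y $ s)"
    unfolding c_def by (rule Min_in) auto
  then obtain s0 where s0: "c = x $ s0 / y $ s0" by blast
  have "c \<le> x $ s / y $ s" for s
    unfolding c_def by (rule Min_le) auto
  then have "c * y $ s \<le> x $ s" for s
    using ypos by (simp add: pos_le_divide_eq)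
  then have nn: "0 \<le> (x - c *\<^sub>R y) $ s" for s by simp
  have "(x - c *\<^sub>R y) v* M = x v* M - c *\<^sub>R (y v* M)"
    by (simp add: vec_eq_iff vector_matrix_mult_def algebra_simps sum_subtractf sum_distrib_left)
  then have st: "(x - c *\<^sub>R y) v* M = x - c *\<^sub>R y"
    by (simp add: x(1) y(1))
  have "(x - c *\<^sub>R y) $ s0 = 0"
    using ypos[of s0] by (simp add: s0)
  from irreducible_stationary_zero[OF M irr st nn this]
  have eq: "x = c *\<^sub>R y" by simp
  then have "(\<Sum>s\<in>UNIV. x $ s) = c * (\<Sum>s\<in>UNIV. y $ s)"
    by (simp add: sum_distrib_left)
  then show ?thesis using eq x(3) y(3) by simp
qed

text \<open>Every limit point of the Cesaro averages of p is stationary, hence equal to d. This replaces the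
  convergence of p itself.\<close>
lemma irreducible_null_functional:
  fixes M :: "real^'s^'s" and p :: "nat \<Rightarrow> real^'s"
  assumes M: "\<And>s s'. 0 \<le> M $ s $ s'" and irr: "irreducible_chain M"
    and d: "d v* M = d" "\<And>s. 0 \<le> d $ s" "(\<Sum>s\<in>UNIV. d $ s) = 1"
    and p: "\<And>t. p (Suc t) = p t v* M" "\<And>t s. 0 \<le> p t $ s" "\<And>t. (\<Sum>s\<in>UNIV. p t $ s) = 1"
    and l: "(\<lambda>t. p t \<bullet> l) \<longlonglongrightarrow> 0"
  shows "d \<bullet> l = 0"
proof -
  define a where "a T = (1 / real (Suc T)) *\<^sub>R (\<Sum>t<Suc T. p t)" for T
  have a_nn: "0 \<le> a T $ s" for T s
    unfolding a_def by (auto simp del: sum.lessThan_Suc intro!: divide_nonneg_nonneg sum_nonneg p(2))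
  have a_sum: "(\<Sum>s\<in>UNIV. a T $ s) = 1" for T
  proof -
    have "(\<Sum>s\<in>UNIV. a T $ s) = (\<Sum>t<Suc T. \<Sum>s\<in>UNIV. p t $ s) / real (Suc T)"
      unfolding a_def by (subst sum.swap) (simp add: sum_divide_distrib[symmetric] del: sum.lessThan_Suc)
    then show ?thesis by (simp add: p(3) del: sum.lessThan_Suc)
  qed
  have norm_le: "norm x \<le> 1" if "\<And>s. 0 \<le> x $ s" "(\<Sum>s\<in>UNIV. x $ s) = 1" for x :: "real^'s"
    using norm_le_l1_cart[of x] that by simp
  \<comment> \<open>Probability vectors lie in the Euclidean unit ball because their 1-norm is 1,
    which yields a convergent subsequence of averages.\<close>
  have "seq_compact (cball 0 1 :: (real^'s) set)"
    by (intro compact_imp_seq_compact compact_cball)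
  moreover have "\<forall>T. a T \<in> cball 0 1"
    using norm_le[OF a_nn a_sum] by simp
  ultimately obtain u r where r: "strict_mono (r :: nat \<Rightarrow> nat)" and u: "(a \<circ> r) \<longlonglongrightarrow> u"
    by (metis seq_compactE)
  have inv: "(\<lambda>T. 1 / real (Suc T)) \<longlonglongrightarrow> 0"
    using LIMSEQ_inverse_real_of_nat by (simp add: inverse_eq_divide)
  have u_nn: "0 \<le> u $ s" for s
    using tendsto_vec_nth[OF u, of s] by (rule LIMSEQ_le_const) (auto simp: a_nn)
  have "(\<lambda>T. \<Sum>s\<in>UNIV. (a \<circ> r) T $ s) \<longlonglongrightarrow> (\<Sum>s\<in>UNIV. u $ s)"
    by (intro tendsto_intros u)
  then have u_sum: "(\<Sum>s\<in>UNIV. u $ s) = 1"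
    by (simp add: a_sum LIMSEQ_const_iff)
  \<comment> \<open>Telescoping leaves two boundary terms of norm at most 1, so the averages are
    stationary up to 2 / (T + 1).\<close>
  have "a T v* M - a T = (1 / real (Suc T)) *\<^sub>R (p (Suc T) - p 0)" for T
  proof -
    have "(\<Sum>t<Suc T. p t) v* M = (\<Sum>t<Suc T. p (Suc t))"
      by (simp add: p(1) vec_eq_iff vector_matrix_mult_def sum_distrib_left sum_distrib_right sum.swap[of _ "{..<Suc T}"] del: sum.lessThan_Suc)
    then have "(\<Sum>t<Suc T. p t) v* M - (\<Sum>t<Suc T. p t) = p (Suc T) - p 0"
      by (simp only: sum_lessThan_telescope sum_subtractf[symmetric])
    then show ?thesis
      by (simp add: a_def scaleR_vector_matrix_assoc scaleR_diff_right[symmetric] del: sum.lessThan_Suc)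
  qed
  moreover have "(\<lambda>T. (1 / real (Suc T)) *\<^sub>R (p (Suc T) - p 0)) \<longlonglongrightarrow> 0"
  proof (rule Lim_null_comparison)
    show "\<forall>\<^sub>F T in sequentially. norm ((1 / real (Suc T)) *\<^sub>R (p (Suc T) - p 0)) \<le> 1 / real (Suc T) * 2"
    proof (intro always_eventually allI)
      fix T
      have "norm (p (Suc T) - p 0) \<le> 1 + 1"
        using norm_le[OF p(2,3)] by (intro norm_triangle_le_diff add_mono)
      then show "norm ((1 / real (Suc T)) *\<^sub>R (p (Suc T) - p 0)) \<le> 1 / real (Suc T) * 2"
        by (simp add: divide_right_mono)
    qed
    show "(\<lambda>T. 1 / real (Suc T) * 2) \<longlonglongrightarrow> 0"
      using tendsto_mult_right[OF inv, of 2] by simp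
  qed
  ultimately have "(\<lambda>T. a T v* M - a T) \<longlonglongrightarrow> 0" by simp
  from LIMSEQ_subseq_LIMSEQ[OF this r]
  have "(\<lambda>T. (a \<circ> r) T v* M - (a \<circ> r) T) \<longlonglongrightarrow> 0" by (simp add: o_def)
  moreover have "(\<lambda>T. (a \<circ> r) T v* M - (a \<circ> r) T) \<longlonglongrightarrow> u v* M - u"
  proof (intro tendsto_diff u)
    show "(\<lambda>T. (a \<circ> r) T v* M) \<longlonglongrightarrow> u v* M"
      using bounded_linear.tendsto[OF matrix_vector_mul_bounded_linear[of "transpose M"] u] by simp
  qed
  ultimately have "u v* M - u = 0" using LIMSEQ_unique by blast
  then have "u v* M = u" by simp
  from irreducible_stationary_unique[OF M irr this u_nn u_sum d] have "u = d" .
  have "(\<lambda>T. a T \<bullet> l) \<longlonglongrightarrow> 0"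
    using cesaro_null[OF l] by (simp add: a_def inner_sum_left del: sum.lessThan_Suc)
  from LIMSEQ_subseq_LIMSEQ[OF this r]
  have "(\<lambda>T. (a \<circ> r) T \<bullet> l) \<longlonglongrightarrow> 0" by (simp add: o_def)
  moreover have "(\<lambda>T. (a \<circ> r) T \<bullet> l) \<longlonglongrightarrow> u \<bullet> l"
    by (intro tendsto_intros u)
  ultimately show ?thesis using LIMSEQ_unique \<open>u = d\<close> by blast
qed

section \<open>Finite-dimensional distributions of trajectories\<close>

text \<open>With finitely many states and actions such a function takes finitely many values, each
  on a finite union of cylinders. Measurability and integrability therefore come from this purely
  combinatorial condition.\<close>

definition depends_upto :: "nat \<Rightarrow> ((nat \<Rightarrow> 'x) \<Rightarrow> real) \<Rightarrow> bool" where
  "depends_upto k X \<longleftrightarrow> (\<forall>\<omega> \<omega>'. (\<forall>i\<le>k. \<omega> i = \<omega>' i) \<longrightarrow> X \<omega> = X \<omega>')"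

(* The followon trace at time k involves the states up to time k, but the actions only before time k. *)
definition state_adapted :: "nat \<Rightarrow> ((nat \<Rightarrow> 's \<times> 'a) \<Rightarrow> real) \<Rightarrow> bool" where
  "state_adapted k X \<longleftrightarrow>
     (\<forall>\<omega> \<omega>'. (\<forall>i<k. \<omega> i = \<omega>' i) \<longrightarrow> fst (\<omega> k) = fst (\<omega>' k) \<longrightarrow> X \<omega> = X \<omega>')"

lemma depends_uptoD: "depends_upto k X \<Longrightarrow> (\<And>i. i \<le> k \<Longrightarrow> \<omega> i = \<omega>' i) \<Longrightarrow> X \<omega> = X \<omega>'"
  by (simp add: depends_upto_def)

lemma state_adaptedD:
  "state_adapted k X \<Longrightarrow> (\<And>i. i < k \<Longrightarrow> \<omega> i = \<omega>' i) \<Longrightarrow> fst (\<omega> k) = fst (\<omega>' k) \<Longrightarrow> X \<omega> = X \<omega>'"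
  by (simp add: state_adapted_def)

lemma state_adapted_imp_depends_upto: "state_adapted k X \<Longrightarrow> depends_upto k X"
  by (auto simp: depends_upto_def intro!: state_adaptedD)

lemma depends_upto_mono: "depends_upto k X \<Longrightarrow> k \<le> l \<Longrightarrow> depends_upto l X"
  by (simp add: depends_upto_def)

lemma depends_upto_mult [intro]:
  "depends_upto k X \<Longrightarrow> depends_upto k Y \<Longrightarrow> depends_upto k (\<lambda>\<omega>. X \<omega> * Y \<omega>)"
  unfolding depends_upto_def by metis

lemma depends_upto_coord [intro]: "i \<le> k \<Longrightarrow> depends_upto k (\<lambda>\<omega>. h (\<omega> i))"
  by (simp add: depends_upto_def)

definition transition :: "('s \<Rightarrow> 'a \<Rightarrow> 's pmf) \<Rightarrow> ('s \<Rightarrow> 'a pmf) \<Rightarrow> 's \<times> 'a \<Rightarrow> 's \<times> 'a \<Rightarrow> real" where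
  "transition P \<pi> x y = pmf (P (fst x) (snd x)) (fst y) * pmf (\<pi> (fst y)) (snd y)"

definition path_prob ::
  "('s \<Rightarrow> 'a \<Rightarrow> 's pmf) \<Rightarrow> ('s \<Rightarrow> 'a pmf) \<Rightarrow> 's pmf \<Rightarrow> nat \<Rightarrow> (nat \<Rightarrow> 's \<times> 'a) \<Rightarrow> real" where
  "path_prob P \<pi> d0 k q =
     pmf d0 (fst (q 0)) * pmf (\<pi> (fst (q 0))) (snd (q 0)) * (\<Prod>t<k. transition P \<pi> (q t) (q (Suc t)))"

lemma sets_traj_measure:
  fixes P :: "'s::finite \<Rightarrow> 'a::finite \<Rightarrow> 's pmf"
  shows "sets (traj_measure P \<pi> d0) = sets (PiM UNIV (\<lambda>_. count_space UNIV))"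
proof -
  interpret IT: Ionescu_Tulcea "traj_kernel P \<pi> d0" "\<lambda>_. count_space UNIV" by (rule Ionescu_Tulcea_traj)
  show ?thesis by (simp add: traj_measure_def)
qed

lemma space_traj_measure [simp]:
  fixes P :: "'s::finite \<Rightarrow> 'a::finite \<Rightarrow> 's pmf"
  shows "space (traj_measure P \<pi> d0) = UNIV"
  using sets_eq_imp_space_eq[OF sets_traj_measure] by (simp add: space_PiM)

lemma cylinder_measurable:
  fixes P :: "'s::finite \<Rightarrow> 'a::finite \<Rightarrow> 's pmf"
  shows "{\<omega>. \<forall>i\<le>k. \<omega> i = q i} \<in> sets (traj_measure P \<pi> d0)"
proof -
  have "{\<omega>. \<forall>i\<le>k. \<omega> i = q i} =
    (\<Inter>i\<in>{..k}. (\<lambda>\<omega>. \<omega> i) -` {q i} \<inter> space (PiM UNIV (\<lambda>_. count_space UNIV)))"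
    by (auto simp: space_PiM)
  also have "\<dots> \<in> sets (PiM UNIV (\<lambda>_. count_space UNIV))"
    by (intro sets.finite_INT measurable_sets[OF measurable_component_singleton]) auto
  finally show ?thesis by (simp add: sets_traj_measure)
qed

lemma emeasure_cylinder:
  fixes P :: "'s::finite \<Rightarrow> 'a::finite \<Rightarrow> 's pmf"
  shows "emeasure (traj_measure P \<pi> d0) {\<omega>. \<forall>i\<le>k. \<omega> i = q i} = ennreal (path_prob P \<pi> d0 k q)"
  using emeasure_traj_measure_cylinder[of P \<pi> d0 k "\<lambda>i. fst (q i)" "\<lambda>i. snd (q i)"]
  by (simp add: path_prob_def transition_def)

lemma measure_cylinder:
  fixes P :: "'s::finite \<Rightarrow> 'a::finite \<Rightarrow> 's pmf"
  shows "measure (traj_measure P \<pi> d0) {\<omega>. \<forall>i\<le>k. \<omega> i = q i} = path_prob P \<pi> d0 k q"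
  unfolding measure_def emeasure_cylinder
  by (simp add: path_prob_def transition_def prod_nonneg)

text \<open>Each word \<open>q\<close> in the extensional product is both the index of a cylinder
  and the point at which \<open>X\<close> is evaluated; its default values beyond \<open>k\<close>
  do not affect \<open>X\<close>.\<close>

lemma depends_upto_cylinders:
  fixes X :: "(nat \<Rightarrow> 'x::finite) \<Rightarrow> real"
  assumes "depends_upto k X"
  shows "X \<omega> = (\<Sum>q\<in>PiE {..k} (\<lambda>_. UNIV). X q * indicator {\<omega>. \<forall>i\<le>k. \<omega> i = q i} \<omega>)"
proof -
  have "X q * indicator {\<omega>. \<forall>i\<le>k. \<omega> i = q i} \<omega> = (if q = restrict \<omega> {..k} then X \<omega> else 0)"
    if q: "q \<in> PiE {..k} (\<lambda>_. UNIV)" for q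
  proof (cases "\<forall>i\<le>k. \<omega> i = q i")
    case True
    then have "q = restrict \<omega> {..k}"
      using q by (auto simp: fun_eq_iff PiE_def extensional_def)
    moreover have "X q = X \<omega>"
      using True by (intro depends_uptoD[OF assms]) simp
    ultimately show ?thesis using True by simp
  next
    case False
    then have "q \<noteq> restrict \<omega> {..k}" by auto
    then show ?thesis using False by simp
  qed
  then show ?thesis
    by (simp add: sum.delta finite_PiE cong: sum.cong)
qed

lemma
  fixes P :: "'s::finite \<Rightarrow> 'a::finite \<Rightarrow> 's pmf"
  assumes X: "depends_upto k X"
  shows depends_upto_integrable: "integrable (traj_measure P \<pi> d0) X" (is ?I)
    and depends_upto_integral: "integral\<^sup>L (traj_measure P \<pi> d0) X =
      (\<Sum>q\<in>PiE {..k} (\<lambda>_. UNIV). X q * path_prob P \<pi> d0 k q)" (is ?E)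
proof -
  have ind: "integrable (traj_measure P \<pi> d0) (indicator {\<omega>. \<forall>i\<le>k. \<omega> i = q i} :: _ \<Rightarrow> real)" for q
    by (intro integrable_real_indicator cylinder_measurable) (simp add: emeasure_cylinder)
  have X': "X = (\<lambda>\<omega>. \<Sum>q\<in>PiE {..k} (\<lambda>_. UNIV). X q * indicator {\<omega>. \<forall>i\<le>k. \<omega> i = q i} \<omega>)"
    using depends_upto_cylinders[OF X] by (rule ext)
  show ?I
    by (rule ssubst[where P="integrable _", OF X']) (auto intro!: ind)
  show ?E
    by (rule trans[OF arg_cong[OF X']]) (simp add: ind Bochner_Integration.integral_sum measure_cylinder)
qed

lemma integral_initial:
  fixes P :: "'s::finite \<Rightarrow> 'a::finite \<Rightarrow> 's pmf"
  assumes X: "depends_upto 0 X"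
  shows "integral\<^sup>L (traj_measure P \<pi> d0) X =
    (\<Sum>y\<in>UNIV. pmf d0 (fst y) * pmf (\<pi> (fst y)) (snd y) * X (\<lambda>_. y))"
proof -
  have "PiE {..0::nat} (\<lambda>_. UNIV :: ('s \<times> 'a) set) = (\<lambda>y. restrict (\<lambda>_. y) {0}) ` UNIV"
    by (auto simp: image_def PiE_def extensional_def fun_eq_iff restrict_def)
  moreover have "inj (\<lambda>y. restrict (\<lambda>_::nat. y :: 's \<times> 'a) {0})"
    by (auto simp: inj_def fun_eq_iff)
  moreover have "X (restrict (\<lambda>_. y) {0}) = X (\<lambda>_. y)" for y
    by (intro depends_uptoD[OF X]) auto
  ultimately show ?thesis
    by (simp add: depends_upto_integral[OF X] sum.reindex path_prob_def mult.commute)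
qed

text \<open>The Markov property in integrated form: the path weight factors into that of the word up
  to time \<open>k\<close> and one transition, so the last coordinate can be averaged out.\<close>

lemma integral_step:
  fixes P :: "'s::finite \<Rightarrow> 'a::finite \<Rightarrow> 's pmf"
  assumes X: "depends_upto (Suc k) X"
  shows "integral\<^sup>L (traj_measure P \<pi> d0) X =
    (\<integral>\<omega>. (\<Sum>y\<in>UNIV. transition P \<pi> (\<omega> k) y * X (\<omega> (Suc k := y))) \<partial>traj_measure P \<pi> d0)"
proof -
  let ?U = "\<lambda>_::nat. UNIV :: ('s \<times> 'a) set"
  have "depends_upto k (\<lambda>\<omega>. \<Sum>y\<in>UNIV. transition P \<pi> (\<omega> k) y * X (\<omega> (Suc k := y)))"
    unfolding depends_upto_def
    by (auto intro!: sum.cong arg_cong2[where f="(*)"] depends_uptoD[OF X])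
  note rhs = depends_upto_integral[OF this, of P \<pi> d0]
  have split: "PiE {..Suc k} ?U = (\<lambda>(y, g). g(Suc k := y)) ` (UNIV \<times> PiE {..k} ?U)"
    by (simp add: atMost_Suc PiE_insert_eq)
  have inj: "inj_on (\<lambda>(y, g). g(Suc k := y)) (UNIV \<times> PiE {..k} ?U)"
    using inj_combinator[of "Suc k" "{..k}" ?U] by simp
  have path: "path_prob P \<pi> d0 (Suc k) (q(Suc k := y)) = path_prob P \<pi> d0 k q * transition P \<pi> (q k) y" for q y
  proof -
    have "(\<Prod>t<k. transition P \<pi> ((q(Suc k := y)) t) ((q(Suc k := y)) (Suc t))) =
      (\<Prod>t<k. transition P \<pi> (q t) (q (Suc t)))"
      by (intro prod.cong) auto
    then show ?thesis
      by (simp add: path_prob_def del: fun_upd_apply) simp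
  qed
  have "integral\<^sup>L (traj_measure P \<pi> d0) X =
    (\<Sum>y\<in>UNIV. \<Sum>q\<in>PiE {..k} ?U. X (q(Suc k := y)) * (path_prob P \<pi> d0 k q * transition P \<pi> (q k) y))"
    unfolding depends_upto_integral[OF X] split
    by (subst sum.reindex[OF inj]) (simp add: sum.cartesian_product path case_prod_beta)
  also have "\<dots> = (\<Sum>q\<in>PiE {..k} ?U. \<Sum>y\<in>UNIV. X (q(Suc k := y)) * (path_prob P \<pi> d0 k q * transition P \<pi> (q k) y))"
    by (rule sum.swap)
  also have "\<dots> = (\<Sum>q\<in>PiE {..k} ?U. (\<Sum>y\<in>UNIV. transition P \<pi> (q k) y * X (q(Suc k := y))) * path_prob P \<pi> d0 k q)"
    by (simp add: sum_distrib_left sum_distrib_right mult_ac)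
  finally show ?thesis by (simp add: rhs)
qed

section \<open>Averaging out actions and next states\<close>

lemma sum_pair_UNIV: "(\<Sum>y\<in>(UNIV :: ('s::finite \<times> 'a::finite) set). h y) = (\<Sum>s\<in>UNIV. \<Sum>a\<in>UNIV. h (s, a))"
  by (simp add: UNIV_Times_UNIV[symmetric] sum.cartesian_product del: UNIV_Times_UNIV)

text \<open>Given the state at time \<open>m\<close>, the action is drawn from the policy
  independently of the past, and \<open>X\<close> does not see it.\<close>

lemma integral_action_average:
  fixes P :: "'s::finite \<Rightarrow> 'a::finite \<Rightarrow> 's pmf"
  assumes X: "state_adapted m X"
  shows "(\<integral>\<omega>. X \<omega> * h (\<omega> m) \<partial>traj_measure P \<pi> d0) =
    (\<integral>\<omega>. X \<omega> * (\<Sum>a\<in>UNIV. pmf (\<pi> (fst (\<omega> m))) a * h (fst (\<omega> m), a)) \<partial>traj_measure P \<pi> d0)"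
proof -
  \<comment> \<open>The free state weight \<open>p\<close> covers both laws of the pair at time
    \<open>m\<close>: the initial one, and the one after a transition.\<close>
  have avg: "(\<Sum>y\<in>UNIV. p (fst y) * pmf (\<pi> (fst y)) (snd y) * (Z y * h y)) =
    (\<Sum>y\<in>UNIV. p (fst y) * pmf (\<pi> (fst y)) (snd y) * (Z y * (\<Sum>a\<in>UNIV. pmf (\<pi> (fst y)) a * h (fst y, a))))"
    if Z: "\<And>s a b. Z (s, a) = Z (s, b)" for p and Z :: "'s \<times> 'a \<Rightarrow> real"
  proof -
    have "(\<Sum>a\<in>UNIV. p s * pmf (\<pi> s) a * (Z (s, a) * h (s, a))) =
      (\<Sum>a\<in>UNIV. p s * pmf (\<pi> s) a * (Z (s, a) * (\<Sum>a\<in>UNIV. pmf (\<pi> s) a * h (s, a))))" for s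
    proof -
      define z where "z = Z (s, undefined)"
      have Zs: "Z (s, a) = z" for a unfolding z_def by (rule Z)
      have "(\<Sum>a\<in>UNIV. pmf (\<pi> s) a) = 1" by (rule sum_pmf_eq_1) auto
      then have "(\<Sum>a\<in>UNIV. pmf (\<pi> s) a * c) = c" for c
        by (simp add: sum_distrib_right[symmetric])
      note one = this[of "p s * z * (\<Sum>a\<in>UNIV. pmf (\<pi> s) a * h (s, a))"]
      have "(\<Sum>a\<in>UNIV. p s * pmf (\<pi> s) a * (Z (s, a) * h (s, a))) =
        p s * z * (\<Sum>a\<in>UNIV. pmf (\<pi> s) a * h (s, a))"
        by (simp add: Zs sum_distrib_left mult_ac)
      also have "\<dots> = (\<Sum>a\<in>UNIV. p s * pmf (\<pi> s) a * (Z (s, a) * (\<Sum>a\<in>UNIV. pmf (\<pi> s) a * h (s, a))))"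
        by (subst one[symmetric]) (simp only: Zs mult_ac)
      finally show ?thesis .
    qed
    then show ?thesis by (simp add: sum_pair_UNIV)
  qed
  have dep: "depends_upto m (\<lambda>\<omega>. X \<omega> * g (\<omega> m))" for g
    by (rule depends_upto_mult[OF state_adapted_imp_depends_upto[OF X] depends_upto_coord[OF order_refl]])
  let ?g = "\<lambda>x. \<Sum>a\<in>UNIV. pmf (\<pi> (fst x)) a * h (fst x, a)"
  show ?thesis
  proof (cases m)
    case 0
    have "X (\<lambda>_. (s, a)) = X (\<lambda>_. (s, b))" for s a b
      by (rule state_adaptedD[OF X]) (auto simp: 0)
    from avg[of "\<lambda>y. X (\<lambda>_. y)", OF this, of "pmf d0"] show ?thesis
      using integral_initial[OF dep[of h, unfolded 0], of P \<pi> d0]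
        integral_initial[OF dep[of ?g, unfolded 0], of P \<pi> d0]
      by (simp add: 0)
  next
    case (Suc k)
    have "X (\<omega> (Suc k := (s, a))) = X (\<omega> (Suc k := (s, b)))" for \<omega> s a b
      by (rule state_adaptedD[OF X]) (auto simp: Suc)
    then have "(\<Sum>y\<in>UNIV. transition P \<pi> (\<omega> k) y * (X (\<omega> (Suc k := y)) * h y)) =
      (\<Sum>y\<in>UNIV. transition P \<pi> (\<omega> k) y * (X (\<omega> (Suc k := y)) * ?g y))" for \<omega>
      unfolding transition_def by (rule avg)
    then show ?thesis
      using integral_step[OF dep[of h, unfolded Suc], of P \<pi> d0]
        integral_step[OF dep[of ?g, unfolded Suc], of P \<pi> d0]
      by (simp add: Suc)
  qed
qed

text \<open>Neither \<open>X\<close> nor \<open>g\<close> looks at the action taken at time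
  \<open>Suc m\<close>, so its probabilities sum to 1 and only \<open>P\<close> remains.\<close>

lemma integral_next_state:
  fixes P :: "'s::finite \<Rightarrow> 'a::finite \<Rightarrow> 's pmf"
  assumes X: "depends_upto m X"
  shows "(\<integral>\<omega>. X \<omega> * g (fst (\<omega> (Suc m))) \<partial>traj_measure P \<pi> d0) =
    (\<integral>\<omega>. X \<omega> * (\<Sum>s\<in>UNIV. pmf (P (fst (\<omega> m)) (snd (\<omega> m))) s * g s) \<partial>traj_measure P \<pi> d0)"
proof -
  have dep: "depends_upto (Suc m) (\<lambda>\<omega>. X \<omega> * g (fst (\<omega> (Suc m))))"
    by (intro depends_upto_mult depends_upto_mono[OF X] depends_upto_coord) auto
  have X': "X (\<omega> (Suc m := y)) = X \<omega>" for \<omega> y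
    by (rule depends_uptoD[OF X]) auto
  have "(\<Sum>a\<in>UNIV. pmf (\<pi> s) a) = 1" for s by (rule sum_pmf_eq_1) auto
  then have one: "(\<Sum>a\<in>UNIV. pmf (\<pi> s) a * c) = c" for c s
    by (simp add: sum_distrib_right[symmetric])
  have "(\<Sum>y\<in>UNIV. transition P \<pi> x y * (c * g (fst y))) =
    c * (\<Sum>s\<in>UNIV. pmf (P (fst x) (snd x)) s * g s)" for x c
  proof -
    have "(\<Sum>a\<in>UNIV. transition P \<pi> x (s, a) * (c * g s)) = c * (pmf (P (fst x) (snd x)) s * g s)" for s
      using one[of s "c * (pmf (P (fst x) (snd x)) s * g s)"] by (simp add: transition_def mult_ac)
    then show ?thesis by (simp add: sum_pair_UNIV sum_distrib_left)
  qed
  then show ?thesis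
    using integral_step[OF dep, of P \<pi> d0] by (simp add: X')
qed

section \<open>The followon trace\<close>

lemma discounted_matrix_vec:
  "(discounted_matrix P \<gamma> \<pi> *v y) $ s = (\<Sum>a\<in>UNIV. pmf (\<pi> s) a * (\<Sum>s'\<in>UNIV. pmf (P s a) s' * (\<gamma> s' * y $ s')))"
proof -
  have "(policy_matrix P \<pi> *v z) $ s = (\<Sum>s'\<in>UNIV. \<Sum>a\<in>UNIV. pmf (\<pi> s) a * (pmf (P s a) s' * z $ s'))" for z
    by (simp add: matrix_vector_mult_def policy_matrix_def sum_distrib_right mult.assoc)
  also have "\<dots> z = (\<Sum>a\<in>UNIV. pmf (\<pi> s) a * (\<Sum>s'\<in>UNIV. pmf (P s a) s' * z $ s'))" for z
    by (subst sum.swap) (simp add: sum_distrib_left)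
  finally show ?thesis
    unfolding discounted_matrix_def by (simp add: matrix_vector_mul_assoc[symmetric])
qed

lemma discounted_matrix_one: "discounted_matrix P (\<lambda>_. 1) \<pi> = policy_matrix P \<pi>"
proof -
  have "diag_mat (\<lambda>_. 1 :: real) = (mat 1 :: real^'a^'a)" by (simp add: diag_mat_def mat_def)
  then show ?thesis by (simp add: discounted_matrix_def)
qed

lemma policy_matrix_nonneg: "0 \<le> policy_matrix P \<pi> $ s $ s'"
  by (simp add: policy_matrix_def sum_nonneg)

lemma discounted_matrix_nonneg:
  assumes "\<And>s. 0 \<le> \<gamma> s"
  shows "0 \<le> discounted_matrix P \<gamma> \<pi> $ s $ s'"
  unfolding discounted_matrix_def matrix_matrix_mult_def
  by (auto intro!: sum_nonneg mult_nonneg_nonneg policy_matrix_nonneg simp: diag_mat_def assms)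

text \<open>w is the importance ratio, or the constant 1 in the on-policy case.\<close>

lemma integral_weighted_step:
  fixes P :: "'s::finite \<Rightarrow> 'a::finite \<Rightarrow> 's pmf"
  assumes X: "state_adapted m X" and w: "\<And>s a. pmf (\<mu> s) a * w (s, a) = pmf (\<pi> s) a"
  shows "(\<integral>\<omega>. X \<omega> * w (\<omega> m) * (\<gamma> (fst (\<omega> (Suc m))) * y $ fst (\<omega> (Suc m))) \<partial>traj_measure P \<mu> d0) =
    (\<integral>\<omega>. X \<omega> * (discounted_matrix P \<gamma> \<pi> *v y) $ fst (\<omega> m) \<partial>traj_measure P \<mu> d0)"
proof -
  have dep: "depends_upto m (\<lambda>\<omega>. X \<omega> * w (\<omega> m))"
    by (rule depends_upto_mult[OF state_adapted_imp_depends_upto[OF X] depends_upto_coord[OF order_refl]])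
  let ?h = "\<lambda>x. w x * (\<Sum>s\<in>UNIV. pmf (P (fst x) (snd x)) s * (\<gamma> s * y $ s))"
  \<comment> \<open>The change of measure: averaging over \<mu> with weight \<open>w\<close> is
    averaging over \<pi>.\<close>
  have "(\<Sum>a\<in>UNIV. pmf (\<mu> s) a * ?h (s, a)) = (discounted_matrix P \<gamma> \<pi> *v y) $ s" for s
    by (simp add: discounted_matrix_vec mult.assoc[symmetric] w)
  then show ?thesis
    using integral_next_state[OF dep, where g="\<lambda>s. \<gamma> s * y $ s" and P=P and \<pi>=\<mu> and ?d0.0=d0]
      integral_action_average[OF X, where h="?h" and P=P and \<pi>=\<mu> and ?d0.0=d0]
    by (simp add: mult.assoc)
qed

text \<open>The factor with index i uses the action at time i but the discount of the state at time
  i + 1. The product thus reaches the state at \<open>u + k\<close> without touching the action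
  there, which is what the next averaging step requires.\<close>

lemma state_adapted_weights:
  assumes "state_adapted u X"
  shows "state_adapted (u + k) (\<lambda>\<omega>. X \<omega> * (\<Prod>i\<in>{u..<u+k}. w (\<omega> i) * \<gamma> (fst (\<omega> (i+1)))))"
  unfolding state_adapted_def
proof (intro allI impI)
  fix \<omega> \<omega>' :: "nat \<Rightarrow> 'a \<times> 'b"
  assume eq: "\<forall>i<u + k. \<omega> i = \<omega>' i" "fst (\<omega> (u + k)) = fst (\<omega>' (u + k))"
  have fst_eq: "fst (\<omega> i) = fst (\<omega>' i)" if "i \<le> u + k" for i
    using that eq by (cases "i = u + k") auto
  have "X \<omega> = X \<omega>'"
    using eq fst_eq by (intro state_adaptedD[OF assms]) auto
  moreover have "(\<Prod>i\<in>{u..<u+k}. w (\<omega> i) * \<gamma> (fst (\<omega> (i+1)))) = (\<Prod>i\<in>{u..<u+k}. w (\<omega>' i) * \<gamma> (fst (\<omega>' (i+1))))"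
    using eq(1) fst_eq by (intro prod.cong) auto
  ultimately show "X \<omega> * (\<Prod>i\<in>{u..<u+k}. w (\<omega> i) * \<gamma> (fst (\<omega> (i+1)))) =
    X \<omega>' * (\<Prod>i\<in>{u..<u+k}. w (\<omega>' i) * \<gamma> (fst (\<omega>' (i+1))))" by simp
qed

text \<open>Peeling off the last factor applies the discounted matrix once to \<open>y\<close>;
  hence the induction generalises \<open>y\<close> and splits the power on the right.\<close>

lemma integral_weighted_path:
  fixes P :: "'s::finite \<Rightarrow> 'a::finite \<Rightarrow> 's pmf"
  assumes X: "state_adapted u X" and w: "\<And>s a. pmf (\<mu> s) a * w (s, a) = pmf (\<pi> s) a"
  shows "(\<integral>\<omega>. X \<omega> * (\<Prod>i\<in>{u..<u+k}. w (\<omega> i) * \<gamma> (fst (\<omega> (i+1)))) * y $ fst (\<omega> (u+k)) \<partial>traj_measure P \<mu> d0) =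
    (\<integral>\<omega>. X \<omega> * (mat_pow (discounted_matrix P \<gamma> \<pi>) k *v y) $ fst (\<omega> u) \<partial>traj_measure P \<mu> d0)"
proof (induction k arbitrary: y)
  case 0 show ?case by simp
next
  case (Suc k)
  from integral_weighted_step[where \<mu>=\<mu> and \<pi>=\<pi> and w=w, OF state_adapted_weights[OF X, of k w \<gamma>] w,
      where \<gamma>=\<gamma> and y=y and P=P and ?d0.0=d0]
  have "(\<integral>\<omega>. X \<omega> * (\<Prod>i\<in>{u..<u+Suc k}. w (\<omega> i) * \<gamma> (fst (\<omega> (i+1)))) * y $ fst (\<omega> (u+Suc k)) \<partial>traj_measure P \<mu> d0) =
    (\<integral>\<omega>. X \<omega> * (\<Prod>i\<in>{u..<u+k}. w (\<omega> i) * \<gamma> (fst (\<omega> (i+1)))) * (discounted_matrix P \<gamma> \<pi> *v y) $ fst (\<omega> (u+k)) \<partial>traj_measure P \<mu> d0)"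
    by (simp add: prod.atLeastLessThan_Suc mult_ac)
  then show ?case by (simp only: Suc mat_pow_Suc_vec2)
qed

text \<open>Splitting by the state at time \<open>t\<close> turns an expectation into an inner
  product with a vector of masses. Identities between mass vectors can then be proved by testing
  against all \<open>y\<close>.\<close>

lemma integral_state_pairing:
  fixes P :: "'s::finite \<Rightarrow> 'a::finite \<Rightarrow> 's pmf"
  assumes X: "depends_upto t X"
  shows "(\<integral>\<omega>. X \<omega> * y $ fst (\<omega> t) \<partial>traj_measure P \<mu> d0) =
    (\<chi> s. \<integral>\<omega>. X \<omega> * indicator {\<omega>. fst (\<omega> t) = s} \<omega> \<partial>traj_measure P \<mu> d0) \<bullet> y"
proof -
  have dep: "depends_upto t (\<lambda>\<omega>. X \<omega> * indicator {\<omega>. fst (\<omega> t) = s} \<omega>)" for s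
    using depends_upto_mult[OF X depends_upto_coord[OF order_refl, where h="\<lambda>x. if fst x = s then 1 else 0"]]
    by (simp add: indicator_def of_bool_def)
  have "X \<omega> * y $ fst (\<omega> t) = (\<Sum>s\<in>UNIV. (X \<omega> * indicator {\<omega>. fst (\<omega> t) = s} \<omega>) * y $ s)" for \<omega>
  proof -
    have "(X \<omega> * indicator {\<omega>. fst (\<omega> t) = s} \<omega>) * y $ s = (if fst (\<omega> t) = s then X \<omega> * y $ s else 0)" for s
      by (simp add: indicator_def)
    then show ?thesis by (simp add: sum.delta)
  qed
  then have "(\<integral>\<omega>. X \<omega> * y $ fst (\<omega> t) \<partial>traj_measure P \<mu> d0) =
    (\<Sum>s\<in>UNIV. (\<integral>\<omega>. X \<omega> * indicator {\<omega>. fst (\<omega> t) = s} \<omega> \<partial>traj_measure P \<mu> d0) * y $ s)"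
    by (simp add: depends_upto_integrable[OF dep])
  then show ?thesis by (simp add: inner_vec_def)
qed

text \<open>The factor 1 gives the law of the state the same shape as the mass of the trace, with
  the trace replaced by 1, so that the two can be compared under the integral.\<close>

definition state_dist ::
  "('s::finite \<Rightarrow> 'a::finite \<Rightarrow> 's pmf) \<Rightarrow> ('s \<Rightarrow> 'a pmf) \<Rightarrow> 's pmf \<Rightarrow> nat \<Rightarrow> real^'s" where
  "state_dist P \<mu> d0 t = (\<chi> s. \<integral>\<omega>. 1 * indicator {\<omega>. fst (\<omega> t) = s} \<omega> \<partial>traj_measure P \<mu> d0)"

text \<open>The unnormalised conditional expectation. Its recursion is linear, whereas the
  conditional one would divide by the probability of the state.\<close>

definition followon_mass where
  "followon_mass P \<gamma> n \<pi> \<mu> d0 t =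
     (\<chi> s. \<integral>\<omega>. followon \<gamma> n \<pi> \<mu> \<omega> t * indicator {\<omega>. fst (\<omega> t) = s} \<omega> \<partial>traj_measure P \<mu> d0)"

lemma state_adapted_const [simp]: "state_adapted k (\<lambda>_. c)"
  by (simp add: state_adapted_def)

lemma state_adapted_comp: "state_adapted k X \<Longrightarrow> state_adapted k (\<lambda>\<omega>. h (X \<omega>))"
  unfolding state_adapted_def by metis

lemma integral_initial_state:
  fixes P :: "'s::finite \<Rightarrow> 'a::finite \<Rightarrow> 's pmf"
  shows "(\<integral>\<omega>. h (fst (\<omega> 0)) \<partial>traj_measure P \<mu> d0) = (\<Sum>s\<in>UNIV. pmf d0 s * h s)"
proof -
  have one: "(\<Sum>a\<in>UNIV. pmf (\<mu> s) a) = 1" for s by (rule sum_pmf_eq_1) auto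
  have "depends_upto 0 (\<lambda>\<omega> :: nat \<Rightarrow> 's \<times> 'a. h (fst (\<omega> 0)))"
    by (simp add: depends_upto_def)
  from integral_initial[OF this, of P \<mu> d0] show ?thesis
    by (simp add: sum_pair_UNIV sum_distrib_left[symmetric] sum_distrib_right[symmetric] one)
qed

lemma integral_state_dist:
  fixes P :: "'s::finite \<Rightarrow> 'a::finite \<Rightarrow> 's pmf"
  shows "(\<integral>\<omega>. y $ fst (\<omega> t) \<partial>traj_measure P \<mu> d0) = state_dist P \<mu> d0 t \<bullet> y"
  using integral_state_pairing[where t=t and X="\<lambda>_. 1" and y=y and P=P and \<mu>=\<mu> and ?d0.0=d0] by (simp add: state_dist_def depends_upto_def)

text \<open>The weighted step with ratio 1 and discount 1.\<close>

lemma state_dist_Suc: "state_dist P \<mu> d0 (Suc t) = state_dist P \<mu> d0 t v* policy_matrix P \<mu>"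
proof -
  have "state_dist P \<mu> d0 (Suc t) \<bullet> y = (state_dist P \<mu> d0 t v* policy_matrix P \<mu>) \<bullet> y" for y
    using integral_weighted_step[where m=t and X="\<lambda>_. 1" and \<mu>=\<mu> and w="\<lambda>_. 1" and \<pi>=\<mu> and \<gamma>="\<lambda>_. 1"
      and y=y and P=P and ?d0.0=d0]
    by (simp add: integral_state_dist discounted_matrix_one dot_lmul_matrix)
  then show ?thesis using vector_eq_rdot by blast
qed

lemma state_dist_nonneg: "0 \<le> state_dist P \<mu> d0 t $ s"
  by (simp add: state_dist_def)

lemma state_dist_sum: "(\<Sum>s\<in>UNIV. state_dist P \<mu> d0 t $ s) = 1"
proof -
  have "(\<integral>\<omega>. (1 :: real) \<partial>traj_measure P \<mu> d0) = 1"
    using integral_initial_state[where h="\<lambda>_. 1" and P=P and \<mu>=\<mu> and ?d0.0=d0] by (simp add: sum_pmf_eq_1)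
  then show ?thesis
    using integral_state_dist[where y="\<chi> _. 1" and t=t and P=P and \<mu>=\<mu> and ?d0.0=d0] by (simp add: inner_vec_def)
qed

lemma followon_adapted: "state_adapted t (\<lambda>\<omega>. followon \<gamma> n \<pi> \<mu> \<omega> t)"
proof (induction t rule: less_induct)
  case (less t)
  show ?case
  proof (cases "n = 0 \<or> t < n")
    case True
    then show ?thesis by (simp add: followon.simps[of _ _ _ _ _ t])
  next
    case False
    then have IH: "state_adapted (t - n) (\<lambda>\<omega>. followon \<gamma> n \<pi> \<mu> \<omega> (t - n))"
      by (intro less) auto
    have "t - n + n = t" using False by simp
    with state_adapted_weights[OF IH, of n "is_ratio \<pi> \<mu>" \<gamma>]
    have "state_adapted t (\<lambda>\<omega>. followon \<gamma> n \<pi> \<mu> \<omega> (t - n) *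
      (\<Prod>i\<in>{t-n..<t}. is_ratio \<pi> \<mu> (\<omega> i) * \<gamma> (fst (\<omega> (i+1)))))" by (simp only:)
    note state_adapted_comp[OF this, of "\<lambda>x. x + 1"]
    moreover have "followon \<gamma> n \<pi> \<mu> \<omega> t = followon \<gamma> n \<pi> \<mu> \<omega> (t - n) *
      (\<Prod>i\<in>{t-n..<t}. is_ratio \<pi> \<mu> (\<omega> i) * \<gamma> (fst (\<omega> (i+1)))) + 1" for \<omega>
      using False by (subst followon.simps) (simp add: mult.commute)
    ultimately show ?thesis by (simp only:)
  qed
qed

lemma followon_ge_1:
  assumes "\<And>s. 0 \<le> \<gamma> s"
  shows "1 \<le> followon \<gamma> n \<pi> \<mu> \<omega> t"
proof (induction t rule: less_induct)
  case (less t)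
  show ?case
  proof (cases "n = 0 \<or> t < n")
    case True
    then show ?thesis by (simp add: followon.simps[of _ _ _ _ _ t])
  next
    case False
    then have "1 \<le> followon \<gamma> n \<pi> \<mu> \<omega> (t - n)" by (intro less) auto
    then have "0 \<le> (\<Prod>i\<in>{t-n..<t}. is_ratio \<pi> \<mu> (\<omega> i) * \<gamma> (fst (\<omega> (i+1)))) * followon \<gamma> n \<pi> \<mu> \<omega> (t-n)"
      by (intro mult_nonneg_nonneg prod_nonneg) (auto simp: is_ratio_def assms)
    then show ?thesis using False by (subst followon.simps) auto
  qed
qed

text \<open>The trace at \<open>t + n\<close> is the trace at \<open>t\<close> times n weights, plus
  1. The change of measure turns the weights into n applications of the discounted matrix of \<pi>;
  the summand 1 contributes the law of the state.\<close>

lemma followon_mass_rec: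
  fixes P :: "'s::finite \<Rightarrow> 'a::finite \<Rightarrow> 's pmf"
  assumes n: "1 \<le> n" and cov: "\<And>s a. pmf (\<pi> s) a > 0 \<Longrightarrow> pmf (\<mu> s) a > 0"
  shows "followon_mass P \<gamma> n \<pi> \<mu> d0 (t + n) =
    followon_mass P \<gamma> n \<pi> \<mu> d0 t v* mat_pow (discounted_matrix P \<gamma> \<pi>) n + state_dist P \<mu> d0 (t + n)"
    (is "?m (t + n) = ?m t v* ?G + ?p (t + n)")
proof -
  \<comment> \<open>If \<mu> gives the action probability zero, the ratio is 0 by division by zero,
    and coverage makes the right-hand side 0 as well.\<close>
  have w: "pmf (\<mu> s) a * is_ratio \<pi> \<mu> (s, a) = pmf (\<pi> s) a" for s a
    using cov[of s a] pmf_nonneg[of "\<pi> s" a] by (cases "pmf (\<mu> s) a = 0") (auto simp: is_ratio_def order_le_less)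
  have pair: "(\<integral>\<omega>. followon \<gamma> n \<pi> \<mu> \<omega> t * y $ fst (\<omega> t) \<partial>traj_measure P \<mu> d0) = ?m t \<bullet> y" for t y
    unfolding followon_mass_def
    by (rule integral_state_pairing[OF state_adapted_imp_depends_upto[OF followon_adapted]])
  have "?m (t + n) \<bullet> y = (?m t v* ?G + ?p (t + n)) \<bullet> y" for y
  proof -
    let ?X = "\<lambda>\<omega>. followon \<gamma> n \<pi> \<mu> \<omega> t * (\<Prod>i\<in>{t..<t+n}. is_ratio \<pi> \<mu> (\<omega> i) * \<gamma> (fst (\<omega> (i+1))))"
    have F: "followon \<gamma> n \<pi> \<mu> \<omega> (t + n) = ?X \<omega> + 1" for \<omega>
      using n by (subst followon.simps) (simp add: mult.commute)
    have i1: "integrable (traj_measure P \<mu> d0) (\<lambda>\<omega>. ?X \<omega> * y $ fst (\<omega> (t + n)))"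
      by (intro depends_upto_integrable[of "t + n"] depends_upto_mult[OF state_adapted_imp_depends_upto
           depends_upto_coord[OF order_refl, where h="\<lambda>x. y $ fst x"]] state_adapted_weights followon_adapted)
    have i2: "integrable (traj_measure P \<mu> d0) (\<lambda>\<omega>. y $ fst (\<omega> (t + n)))"
      by (intro depends_upto_integrable[of "t + n"] depends_upto_coord[OF order_refl, where h="\<lambda>x. y $ fst x"])
    have "?m (t + n) \<bullet> y = (\<integral>\<omega>. ?X \<omega> * y $ fst (\<omega> (t + n)) + y $ fst (\<omega> (t + n)) \<partial>traj_measure P \<mu> d0)"
      unfolding pair[symmetric] F by (simp add: distrib_right)
    also have "\<dots> = (\<integral>\<omega>. ?X \<omega> * y $ fst (\<omega> (t + n)) \<partial>traj_measure P \<mu> d0) + ?p (t + n) \<bullet> y"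
      by (subst Bochner_Integration.integral_add[OF i1 i2]) (simp only: integral_state_dist)
    also have "(\<integral>\<omega>. ?X \<omega> * y $ fst (\<omega> (t + n)) \<partial>traj_measure P \<mu> d0) = ?m t \<bullet> (?G *v y)"
      unfolding integral_weighted_path[where \<mu>=\<mu> and \<pi>=\<pi>, OF followon_adapted w] pair ..
    finally show ?thesis by (simp add: inner_add_left dot_lmul_matrix)
  qed
  then show ?thesis using vector_eq_rdot by blast
qed

section \<open>From masses to conditional expectations\<close>

lemma integral_uniform_measure_real:
  fixes X :: "'w \<Rightarrow> real"
  assumes "E \<in> sets M" "emeasure M E \<noteq> 0" "emeasure M E \<noteq> \<infinity>" "X \<in> borel_measurable M"
  shows "measure M E * (\<integral>\<omega>. X \<omega> \<partial>uniform_measure M E) = (\<integral>\<omega>. X \<omega> * indicator E \<omega> \<partial>M)"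
proof -
  have e: "emeasure M E = ennreal (measure M E)"
    using assms(3) by (simp add: emeasure_eq_ennreal_measure top.not_eq_extremum less_top)
  have pos: "0 < measure M E"
    using assms(2) by (simp add: e zero_less_measure_iff)
  have "uniform_measure M E = density M (\<lambda>x. ennreal (indicator E x / measure M E))"
    unfolding uniform_measure_def e
    by (intro arg_cong[where f="density M"] ext) (auto simp: indicator_def divide_ennreal[symmetric] pos)
  moreover have "(\<integral>\<omega>. X \<omega> \<partial>density M (\<lambda>x. ennreal (indicator E x / measure M E))) =
    (\<integral>\<omega>. (indicator E \<omega> / measure M E) *\<^sub>R X \<omega> \<partial>M)"
    using assms(1,4) pos by (intro integral_density) auto
  ultimately show ?thesis
    using pos by (simp add: mult.commute)
qed

text \<open>For a state of probability zero both sides vanish, whatever value the conditional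
  expectation takes there.\<close>

lemma followon_mass_expected:
  fixes P :: "'s::finite \<Rightarrow> 'a::finite \<Rightarrow> 's pmf"
  shows "followon_mass P \<gamma> n \<pi> \<mu> d0 t $ s =
    state_dist P \<mu> d0 t $ s * expected_followon P \<gamma> n \<pi> \<mu> d0 t s"
proof -
  let ?M = "traj_measure P \<mu> d0" and ?E = "{\<omega>. fst (\<omega> t) = s}"
  let ?X = "\<lambda>\<omega>. followon \<gamma> n \<pi> \<mu> \<omega> t"
  have "depends_upto t (indicator ?E :: _ \<Rightarrow> real)"
    by (simp add: depends_upto_def indicator_def)
  note iE = depends_upto_integrable[OF this, of P \<mu> d0]
  then have E: "?E \<in> sets ?M" "emeasure ?M ?E \<noteq> \<infinity>"
    by (auto simp: integrable_indicator_iff)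
  have p: "state_dist P \<mu> d0 t $ s = measure ?M ?E"
    by (simp add: state_dist_def)
  have X: "?X \<in> borel_measurable ?M"
    using depends_upto_integrable[OF state_adapted_imp_depends_upto[OF followon_adapted]] by blast
  show ?thesis
  proof (cases "emeasure ?M ?E = 0")
    case False
    then show ?thesis
      using integral_uniform_measure_real[OF E(1) False E(2) X]
      by (simp add: p followon_mass_def expected_followon_def cond_expect_def)
  next
    case True
    then have "AE \<omega> in ?M. \<omega> \<notin> ?E"
      using E(1) by (simp add: AE_iff_null null_sets_def)
    then have "(\<integral>\<omega>. ?X \<omega> * indicator ?E \<omega> \<partial>?M) = 0"
      by (intro integral_eq_zero_AE) auto
    then show ?thesis using True by (simp add: p followon_mass_def measure_def)
  qed
qed

text \<open>The trace is at least 1 on every trajectory, but this passes to the conditional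
  expectation only when the event has positive probability.\<close>

lemma expected_followon_ge_1:
  fixes P :: "'s::finite \<Rightarrow> 'a::finite \<Rightarrow> 's pmf"
  assumes "\<And>s. 0 \<le> \<gamma> s" and p: "0 < state_dist P \<mu> d0 t $ s"
  shows "1 \<le> expected_followon P \<gamma> n \<pi> \<mu> d0 t s"
proof -
  let ?M = "traj_measure P \<mu> d0" and ?E = "{\<omega>. fst (\<omega> t) = s}"
  have "depends_upto t (\<lambda>\<omega>. X \<omega> * indicator ?E \<omega>)" if "depends_upto t X" for X
    by (intro depends_upto_mult that) (simp add: depends_upto_def indicator_def)
  note i = depends_upto_integrable[OF this, of _ P \<mu> d0]
  have "state_dist P \<mu> d0 t $ s \<le> followon_mass P \<gamma> n \<pi> \<mu> d0 t $ s"
    unfolding state_dist_def followon_mass_def vec_lambda_beta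
    by (intro integral_mono i mult_right_mono followon_ge_1 assms state_adapted_imp_depends_upto[OF followon_adapted])
      (auto simp: depends_upto_def)
  then show ?thesis
    using p by (simp add: followon_mass_expected)
qed

section \<open>The Bellman and the emphasis equation\<close>

text \<open>The reward depends on the action at time \<open>k\<close>, so it is averaged over that
  action before the discounts are moved back to time 0 with ratio 1.\<close>

lemma integral_discounted_reward:
  fixes P :: "'s::finite \<Rightarrow> 'a::finite \<Rightarrow> 's pmf"
  shows "(\<integral>\<omega>. (\<Prod>j\<in>{1..k}. \<gamma> (fst (\<omega> j))) * r (fst (\<omega> k)) (snd (\<omega> k)) \<partial>traj_measure P \<pi> (return_pmf s)) =
    (mat_pow (discounted_matrix P \<gamma> \<pi>) k *v policy_reward r \<pi>) $ s" (is ?eq)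
    and depends_upto_discounted_reward:
      "depends_upto k (\<lambda>\<omega>. (\<Prod>j\<in>{1..k}. \<gamma> (fst (\<omega> j))) * r (fst (\<omega> k)) (snd (\<omega> k)))" (is ?dep)
proof -
  let ?X = "\<lambda>\<omega> :: nat \<Rightarrow> 's \<times> 'a. \<Prod>j\<in>{1..k}. \<gamma> (fst (\<omega> j))"
  \<comment> \<open>Index shift between the weights, which attach the discount of the state at i + 1
    to index i, and the return, which counts from 1 to \<open>k\<close>.\<close>
  have prod_eq: "1 * (\<Prod>i\<in>{0..<0+k}. 1 * \<gamma> (fst (\<omega> (i+1)))) = ?X \<omega>" for \<omega> :: "nat \<Rightarrow> 's \<times> 'a"
    using prod.shift_bounds_nat_ivl[of "\<lambda>j. \<gamma> (fst (\<omega> j))" 0 1 k] by (simp add: atLeastLessThanSuc_atLeastAtMost)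
  have X: "state_adapted k ?X"
    using state_adapted_weights[where u=0 and X="\<lambda>_ :: nat \<Rightarrow> 's \<times> 'a. 1" and k=k and w="\<lambda>_. 1" and \<gamma>=\<gamma>]
    unfolding prod_eq by simp
  show ?dep
    by (rule depends_upto_mult[OF state_adapted_imp_depends_upto[OF X]
        depends_upto_coord[OF order_refl, where h="\<lambda>x. r (fst x) (snd x)"]])
  have "(\<integral>\<omega>. ?X \<omega> * r (fst (\<omega> k)) (snd (\<omega> k)) \<partial>traj_measure P \<pi> (return_pmf s)) =
    (\<integral>\<omega>. ?X \<omega> * policy_reward r \<pi> $ fst (\<omega> k) \<partial>traj_measure P \<pi> (return_pmf s))"
    using integral_action_average[OF X, where h="\<lambda>x. r (fst x) (snd x)" and P=P and \<pi>=\<pi>]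
    by (simp add: policy_reward_def)
  also have "\<dots> = (\<integral>\<omega>. (mat_pow (discounted_matrix P \<gamma> \<pi>) k *v policy_reward r \<pi>) $ fst (\<omega> 0)
      \<partial>traj_measure P \<pi> (return_pmf s))"
    using integral_weighted_path[where u=0 and X="\<lambda>_. 1" and \<mu>=\<pi> and w="\<lambda>_. 1" and \<pi>=\<pi> and k=k and \<gamma>=\<gamma>
        and y="policy_reward r \<pi>" and P=P and ?d0.0="return_pmf s", unfolded prod_eq]
    by simp
  finally show ?eq
    unfolding integral_initial_state[where h="\<lambda>s. (mat_pow (discounted_matrix P \<gamma> \<pi>) k *v policy_reward r \<pi>) $ s"]
    by (simp add: pmf_return indicator_def if_distrib[where f="\<lambda>x. x * _"] cong: if_cong)
qed

text \<open>Summability for the reward |r| bounds the expected absolute series. Hence the return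
  converges absolutely almost everywhere, so \<open>suminf\<close> is a genuine sum there, and
  integral and series may be exchanged.\<close>

lemma value_fun_suminf:
  fixes P :: "'s::finite \<Rightarrow> 'a::finite \<Rightarrow> 's pmf"
  assumes \<gamma>: "\<And>s. 0 \<le> \<gamma> s"
    and summ: "\<And>y s. (\<And>s'. 0 \<le> y $ s') \<Longrightarrow> summable (\<lambda>k. (mat_pow (discounted_matrix P \<gamma> \<pi>) k *v y) $ s)"
  shows "(\<lambda>k. (mat_pow (discounted_matrix P \<gamma> \<pi>) k *v policy_reward r \<pi>) $ s) sums (value_fun P r \<gamma> \<pi> $ s)"
proof -
  let ?M = "traj_measure P \<pi> (return_pmf s)" and ?H = "discounted_matrix P \<gamma> \<pi>"
  let ?F = "\<lambda>r k \<omega>. (\<Prod>j\<in>{1..k}. \<gamma> (fst (\<omega> j))) * r (fst (\<omega> k)) (snd (\<omega> k))"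
  let ?r = "\<lambda>s a. \<bar>r s a\<bar>"
  have int: "integrable ?M (?F r k)" for r k
    by (rule depends_upto_integrable[OF depends_upto_discounted_reward])
  have abs: "norm (?F r k \<omega>) = ?F ?r k \<omega>" for k and \<omega> :: "nat \<Rightarrow> 's \<times> 'a"
    by (simp add: abs_mult abs_prod \<gamma>)
  have sums: "summable (\<lambda>k. \<integral>\<omega>. norm (?F r k \<omega>) \<partial>?M)"
    unfolding abs integral_discounted_reward[where r="?r"]
    by (rule summ) (auto simp: policy_reward_def intro!: sum_nonneg)
  have meas: "(\<lambda>\<omega>. ennreal (norm (?F r k \<omega>))) \<in> borel_measurable ?M" for k
    by (rule measurable_compose[OF borel_measurable_integrable[OF integrable_norm[OF int]] measurable_ennreal])
  have "(\<integral>\<^sup>+\<omega>. (\<Sum>k. ennreal (norm (?F r k \<omega>))) \<partial>?M) = (\<Sum>k. \<integral>\<^sup>+\<omega>. ennreal (norm (?F r k \<omega>)) \<partial>?M)"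
    by (intro nn_integral_suminf meas)
  also have "\<dots> = (\<Sum>k. ennreal (\<integral>\<omega>. norm (?F r k \<omega>) \<partial>?M))"
    using int by (intro suminf_cong nn_integral_eq_integral integrable_norm) auto
  also have "\<dots> \<noteq> \<infinity>"
    unfolding infinity_ennreal_def using sums by (intro ennreal_suminf_neq_top) auto
  finally have "AE \<omega> in ?M. (\<Sum>k. ennreal (norm (?F r k \<omega>))) \<noteq> \<infinity>"
    by (intro nn_integral_PInf_AE borel_measurable_suminf_order meas)
  then have ae: "AE \<omega> in ?M. summable (\<lambda>k. norm (?F r k \<omega>))"
    by eventually_elim (rule summable_suminf_not_top, auto)
  from sums_integral[OF int ae sums] show ?thesis
    unfolding integral_discounted_reward by (simp add: value_fun_def discounted_return_def)
qed

text \<open>Shifting the series by one index gives the one-step equation; the n-step version follows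
  by telescoping.\<close>

lemma Bellman:
  fixes P :: "'s::finite \<Rightarrow> 'a::finite \<Rightarrow> 's pmf"
  assumes "\<And>s. (\<lambda>k. (mat_pow (discounted_matrix P \<gamma> \<pi>) k *v policy_reward r \<pi>) $ s) sums (v $ s)"
  shows "(mat 1 - mat_pow (discounted_matrix P \<gamma> \<pi>) n) *v v = nstep_reward P r \<gamma> n \<pi>"
proof -
  let ?H = "discounted_matrix P \<gamma> \<pi>" and ?r = "policy_reward r \<pi>"
  have step: "?H *v v = v - ?r"
  proof (unfold vec_eq_iff, rule allI)
    fix s
    have "(\<lambda>k. \<Sum>s'\<in>UNIV. ?H $ s $ s' * (mat_pow ?H k *v ?r) $ s') sums (\<Sum>s'\<in>UNIV. ?H $ s $ s' * v $ s')"
      by (intro sums_sum sums_mult assms)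
    then have "(\<lambda>k. (mat_pow ?H (Suc k) *v ?r) $ s) sums ((?H *v v) $ s)"
      unfolding mat_pow_Suc_vec by (simp add: matrix_vector_mult_def[of ?H])
    moreover have "(\<lambda>k. (mat_pow ?H (Suc k) *v ?r) $ s) sums (v $ s - ?r $ s)"
      using assms[of s] by (subst sums_Suc_iff) simp
    ultimately show "(?H *v v) $ s = (v - ?r) $ s"
      using sums_unique2 by fastforce
  qed
  have "nstep_reward P r \<gamma> n \<pi> + mat_pow ?H n *v v = v"
  proof (induction n)
    case 0 show ?case by (simp add: nstep_reward_def)
  next
    case (Suc n)
    have "mat_pow ?H (Suc n) *v v = mat_pow ?H n *v v - mat_pow ?H n *v ?r"
      by (simp add: mat_pow_Suc_vec2 step matrix_vector_mult_diff_distrib)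
    then have "nstep_reward P r \<gamma> (Suc n) \<pi> + mat_pow ?H (Suc n) *v v = nstep_reward P r \<gamma> n \<pi> + mat_pow ?H n *v v"
      by (simp add: nstep_reward_def)
    then show ?case using Suc by (rule trans)
  qed
  then show ?thesis by (simp add: matrix_vector_mult_diff_rdistrib algebra_simps)
qed

text \<open>Decay is known only over blocks of \<open>n\<close> steps. A partial sum is at most the
  first \<open>n\<close> terms plus \<open>c\<close> times itself, which bounds it
  uniformly.\<close>

lemma summable_geometric_recurrence:
  fixes a :: "nat \<Rightarrow> real"
  assumes a: "\<And>k. 0 \<le> a k" and c: "c < 1" and rec: "\<And>k. a (k + n) \<le> c * a k"
  shows "summable a"
proof (rule bounded_imp_summable[OF a])
  fix N
  have "sum a {..N} \<le> sum a {..<n + Suc N}"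
    using a by (intro sum_mono2) auto
  also have "\<dots> = sum a {..<n} + (\<Sum>k<Suc N. a (k + n))"
    using sum.atLeastLessThan_shift_0[of a n "n + Suc N"] sum.atLeastLessThan_concat[of 0 n "n + Suc N" a]
    by (simp add: atLeast0LessThan add.commute del: sum.lessThan_Suc)
  also have "(\<Sum>k<Suc N. a (k + n)) \<le> (\<Sum>k<Suc N. c * a k)"
    by (intro sum_mono rec)
  also have "\<dots> = c * sum a {..N}"
    by (simp add: sum_distrib_left lessThan_Suc_atMost del: sum.lessThan_Suc)
  finally have "(1 - c) * sum a {..N} \<le> sum a {..<n}"
    by (simp add: algebra_simps)
  then show "sum a {..N} \<le> sum a {..<n} / (1 - c)"
    using c by (simp add: pos_le_divide_eq mult.commute)
qed

lemma mat_vec_nonneg: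
  fixes A :: "real^'n^'m"
  assumes "\<And>i j. 0 \<le> A $ i $ j" "\<And>j. 0 \<le> y $ j"
  shows "0 \<le> (A *v y) $ i"
  by (auto simp: matrix_vector_mult_def assms intro!: sum_nonneg)

text \<open>A positive solution x of the emphasis equation is a Lyapunov function for the powers of H.\<close>

lemma emphasis_summable:
  fixes H :: "real^'s^'s"
  assumes H: "\<And>i j. 0 \<le> H $ i $ j" and x: "\<And>i. 0 < x $ i" and d: "\<And>i. 0 < d $ i"
    and eq: "x v* mat_pow H n + d = x" and y: "\<And>i. 0 \<le> y $ i"
  shows "summable (\<lambda>k. (mat_pow H k *v y) $ s)"
proof -
  \<comment> \<open>The largest fraction with \<delta> x \<le> d in every component; x G = x - d is
    then at most (1 - \<delta>) x.\<close>
  define \<delta> where "\<delta> = Min (range (\<lambda>i. d $ i / x $ i))"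
  have "\<delta> \<in> range (\<lambda>i. d $ i / x $ i)"
    unfolding \<delta>_def by (rule Min_in) auto
  then have \<delta>: "0 < \<delta>" using x d by auto
  have "\<delta> \<le> d $ i / x $ i" for i
    unfolding \<delta>_def by (rule Min_le) auto
  then have d_ge: "\<delta> * x $ i \<le> d $ i" for i
    using x by (simp add: pos_le_divide_eq)
  have nn: "0 \<le> (mat_pow H k *v y) $ i" for k i
    by (intro mat_vec_nonneg mat_pow_nonneg H y)
  define a where "a k = x \<bullet> (mat_pow H k *v y)" for k
  have "summable a"
  proof (rule summable_geometric_recurrence)
    show "0 \<le> a k" for k
      unfolding a_def inner_vec_def using nn less_imp_le[OF x] by (auto intro!: sum_nonneg)
    show "1 - \<delta> < 1" using \<delta> by simp
    show "a (k + n) \<le> (1 - \<delta>) * a k" for k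
    proof -
      have "a (k + n) = (x v* mat_pow H n) \<bullet> (mat_pow H k *v y)"
        by (simp add: a_def add.commute[of k] mat_pow_add dot_lmul_matrix matrix_vector_mul_assoc)
      also have "x v* mat_pow H n = x - d" using eq by (simp add: eq_diff_eq)
      also have "(x - d) \<bullet> (mat_pow H k *v y) \<le> ((1 - \<delta>) *\<^sub>R x) \<bullet> (mat_pow H k *v y)"
        unfolding inner_vec_def
      proof (intro sum_mono)
        fix i show "(x - d) $ i \<bullet> (mat_pow H k *v y) $ i \<le> ((1 - \<delta>) *\<^sub>R x) $ i \<bullet> (mat_pow H k *v y) $ i"
          using mult_right_mono[of "x $ i - d $ i" "(1 - \<delta>) * x $ i", OF _ nn[of k i]] d_ge[of i]
          by (simp add: algebra_simps)
      qed
      finally show ?thesis by (simp add: a_def)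
    qed
  qed
  \<comment> \<open>Positivity of \<open>x\<close> lets the weighted sum control each single
    entry.\<close>
  have bound: "x $ s * (mat_pow H k *v y) $ s \<le> a k" for k
    unfolding a_def inner_vec_def
    using nn less_imp_le[OF x] member_le_sum[of s UNIV "\<lambda>i. x $ i * (mat_pow H k *v y) $ i"] by simp
  from \<open>summable a\<close> have "summable (\<lambda>k. x $ s * (mat_pow H k *v y) $ s)"
  proof (rule summable_comparison_test'[where N=0])
    fix k
    have "0 \<le> x $ s * (mat_pow H k *v y) $ s"
      by (intro mult_nonneg_nonneg less_imp_le[OF x] nn)
    then show "norm (x $ s * (mat_pow H k *v y) $ s) \<le> a k"
      using bound[of k] by (simp only: real_norm_def abs_of_nonneg)
  qed
  then show ?thesis
    using x[of s] by (simp only: summable_cmult_iff) auto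
qed

section \<open>The energy estimate\<close>

lemma mat_pow_substochastic:
  fixes H :: "real^'s^'s"
  assumes H: "\<And>i j. 0 \<le> H $ i $ j" and row: "\<And>i. (\<Sum>j\<in>UNIV. H $ i $ j) \<le> 1"
  shows "(\<Sum>j\<in>UNIV. mat_pow H k $ i $ j) \<le> 1"
proof (induction k arbitrary: i)
  case 0 show ?case by (simp add: mat_def)
next
  case (Suc k)
  have "(\<Sum>j\<in>UNIV. mat_pow H (Suc k) $ i $ j) = (\<Sum>l\<in>UNIV. H $ i $ l * (\<Sum>j\<in>UNIV. mat_pow H k $ l $ j))"
    unfolding mat_pow_Suc matrix_matrix_mult_def vec_lambda_beta
    by (subst sum.swap) (simp add: sum_distrib_left)
  also have "\<dots> \<le> (\<Sum>l\<in>UNIV. H $ i $ l * 1)"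
    by (intro sum_mono mult_left_mono Suc H)
  finally show ?case using row[of i] by simp
qed

lemma discounted_matrix_substochastic:
  assumes "\<And>s. 0 \<le> \<gamma> s \<and> \<gamma> s \<le> 1"
  shows "(\<Sum>s'\<in>UNIV. discounted_matrix P \<gamma> \<pi> $ s $ s') \<le> 1"
proof -
  have one: "(\<Sum>s\<in>UNIV. pmf p s) = 1" for p :: "'x::finite pmf" by (rule sum_pmf_eq_1) auto
  have "(\<Sum>s'\<in>UNIV. discounted_matrix P \<gamma> \<pi> $ s $ s') = (discounted_matrix P \<gamma> \<pi> *v (\<chi> _. 1)) $ s"
    by (simp add: matrix_vector_mult_def)
  also have "\<dots> \<le> (\<Sum>a\<in>UNIV. pmf (\<pi> s) a * (\<Sum>s'\<in>UNIV. pmf (P s a) s' * 1))"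
    unfolding discounted_matrix_vec using assms by (intro sum_mono mult_left_mono) auto
  also have "\<dots> = 1" by (simp add: one)
  finally show ?thesis .
qed

text \<open>By 2 y_i y_j \<le> y_i^2 + y_j^2; the emphasis equation absorbs the sum of the second squares.\<close>
lemma emphasis_coercive:
  fixes G :: "real^'s^'s"
  assumes G: "\<And>i j. 0 \<le> G $ i $ j" and row: "\<And>i. (\<Sum>j\<in>UNIV. G $ i $ j) \<le> 1"
    and x: "\<And>i. 0 \<le> x $ i" and eq: "x v* G + d = x"
  shows "(\<Sum>i\<in>UNIV. d $ i * (y $ i)\<^sup>2) / 2 \<le> y \<bullet> (diag_mat (\<lambda>i. x $ i) *v ((mat 1 - G) *v y))"
proof -
  \<comment> \<open>To be read with a the cross term, b the squares weighted by x, and e those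
    weighted by d.\<close>
  have aux: "e / 2 \<le> b - a" if "a \<le> b / 2 + (b - e) / 2" for a b e :: real
    using that by (simp add: field_simps)
  have step: "x $ i * (y $ i * (G *v y) $ i) \<le>
      x $ i * (y $ i)\<^sup>2 / 2 + (\<Sum>j\<in>UNIV. x $ i * G $ i $ j * (y $ j)\<^sup>2) / 2" for i
  proof -
    have "y $ i * (G *v y) $ i = (\<Sum>j\<in>UNIV. G $ i $ j * (y $ i * y $ j))"
      by (simp add: matrix_vector_mult_def sum_distrib_left mult_ac)
    also have "\<dots> \<le> (\<Sum>j\<in>UNIV. G $ i $ j * ((y $ i)\<^sup>2 / 2 + (y $ j)\<^sup>2 / 2))"
    proof (intro sum_mono mult_left_mono G)
      fix j show "y $ i * y $ j \<le> (y $ i)\<^sup>2 / 2 + (y $ j)\<^sup>2 / 2"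
        using sum_squares_bound[of "y $ i" "y $ j"] by simp
    qed
    also have "\<dots> = (\<Sum>j\<in>UNIV. G $ i $ j) * ((y $ i)\<^sup>2 / 2) + (\<Sum>j\<in>UNIV. G $ i $ j * (y $ j)\<^sup>2) / 2"
      by (simp add: distrib_left sum.distrib sum_distrib_right sum_divide_distrib)
    also have "\<dots> \<le> 1 * ((y $ i)\<^sup>2 / 2) + (\<Sum>j\<in>UNIV. G $ i $ j * (y $ j)\<^sup>2) / 2"
      by (intro add_right_mono mult_right_mono row) auto
    finally have "x $ i * (y $ i * (G *v y) $ i) \<le> x $ i * (1 * ((y $ i)\<^sup>2 / 2) + (\<Sum>j\<in>UNIV. G $ i $ j * (y $ j)\<^sup>2) / 2)"
      by (intro mult_left_mono x)
    then show ?thesis by (simp add: distrib_left sum_distrib_left mult.assoc)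
  qed
  have "(\<Sum>i\<in>UNIV. x $ i * (y $ i * (G *v y) $ i)) \<le>
    (\<Sum>i\<in>UNIV. x $ i * (y $ i)\<^sup>2) / 2 + (\<Sum>i\<in>UNIV. \<Sum>j\<in>UNIV. x $ i * G $ i $ j * (y $ j)\<^sup>2) / 2"
    using sum_mono[of UNIV, OF step] by (simp add: sum.distrib sum_divide_distrib)
  also have "(\<Sum>i\<in>UNIV. \<Sum>j\<in>UNIV. x $ i * G $ i $ j * (y $ j)\<^sup>2) = (\<Sum>j\<in>UNIV. (x v* G) $ j * (y $ j)\<^sup>2)"
    by (subst sum.swap) (simp add: vector_matrix_mult_def sum_distrib_left sum_distrib_right mult_ac)
  also have "x v* G = x - d" using eq by (simp add: eq_diff_eq)
  also have "(\<Sum>j\<in>UNIV. (x - d) $ j * (y $ j)\<^sup>2) = (\<Sum>j\<in>UNIV. x $ j * (y $ j)\<^sup>2) - (\<Sum>j\<in>UNIV. d $ j * (y $ j)\<^sup>2)"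
    by (simp add: left_diff_distrib sum_subtractf)
  finally have "(\<Sum>i\<in>UNIV. d $ i * (y $ i)\<^sup>2) / 2 \<le>
    (\<Sum>i\<in>UNIV. x $ i * (y $ i)\<^sup>2) - (\<Sum>i\<in>UNIV. x $ i * (y $ i * (G *v y) $ i))"
    by (rule aux)
  also have "\<dots> = y \<bullet> (diag_mat (\<lambda>i. x $ i) *v ((mat 1 - G) *v y))"
    by (simp add: inner_vec_def matrix_vector_mult_diff_rdistrib sum_subtractf[symmetric] power2_eq_square algebra_simps)
  finally show ?thesis .
qed

lemma sum_weighted_squares_ge:
  fixes y :: "real^'s"
  shows "Min (range d) * (norm y)\<^sup>2 \<le> (\<Sum>i\<in>UNIV. d i * (y $ i)\<^sup>2)"
proof -
  have "Min (range d) * (norm y)\<^sup>2 = (\<Sum>i\<in>UNIV. Min (range d) * (y $ i)\<^sup>2)"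
    unfolding power2_norm_eq_inner inner_vec_def by (simp add: sum_distrib_left power2_eq_square)
  also have "\<dots> \<le> (\<Sum>i\<in>UNIV. d i * (y $ i)\<^sup>2)"
    by (intro sum_mono mult_right_mono Min_le) auto
  finally show ?thesis .
qed

section \<open>The limiting trace\<close>

context
  fixes P :: "'s::finite \<Rightarrow> 'a::finite \<Rightarrow> 's pmf" and \<gamma> :: "'s \<Rightarrow> real" and n :: nat
    and \<pi> \<mu> :: "'s \<Rightarrow> 'a pmf" and d0 d :: "'s pmf" and f :: "'s \<Rightarrow> real"
  assumes \<gamma>: "\<And>s. 0 \<le> \<gamma> s" and n: "1 \<le> n"
    and irr: "irreducible_chain (policy_matrix P \<mu>)"
    and stat: "stationary_distribution (policy_matrix P \<mu>) d"
    and cov: "\<And>s a. pmf (\<pi> s) a > 0 \<Longrightarrow> pmf (\<mu> s) a > 0"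
    and lim: "\<And>s. (\<lambda>t. expected_followon P \<gamma> n \<pi> \<mu> d0 t s) \<longlonglongrightarrow> f s"
begin

lemma stationary_vec:
  shows "(\<chi> s. pmf d s) v* policy_matrix P \<mu> = (\<chi> s. pmf d s)" "0 \<le> (\<chi> s. pmf d s) $ s'"
    "(\<Sum>s\<in>UNIV. (\<chi> s. pmf d s) $ s) = 1"
  using stat by (auto simp: stationary_distribution_def sum_pmf_eq_1)

lemma stationary_pos: "0 < pmf d s"
proof -
  have "(\<chi> s. pmf d s) \<noteq> 0"
    using stationary_vec(3) by (metis sum.neutral zero_index zero_neq_one)
  from irreducible_stationary_pos[OF policy_matrix_nonneg irr stationary_vec(1,2) this, of s]
  show ?thesis by simp
qed

lemma stationary_null:
  assumes "(\<lambda>t. state_dist P \<mu> d0 t \<bullet> l) \<longlonglongrightarrow> 0"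
  shows "(\<chi> s. pmf d s) \<bullet> l = 0"
  by (rule irreducible_null_functional[OF policy_matrix_nonneg irr stationary_vec state_dist_Suc
        state_dist_nonneg state_dist_sum assms])

text \<open>A limit below 1 would force the state to have probability zero at all late times.
  Testing with its unit vector then gives it stationary probability zero, against
  irreducibility.\<close>

lemma emphasis_ge_1: "1 \<le> f s"
proof (rule ccontr)
  assume "\<not> 1 \<le> f s"
  then have "eventually (\<lambda>t. expected_followon P \<gamma> n \<pi> \<mu> d0 t s < 1) sequentially"
    using order_tendstoD(2)[OF lim] by auto
  then have "eventually (\<lambda>t. state_dist P \<mu> d0 t \<bullet> axis s 1 = 0) sequentially"
  proof eventually_elim
    case (elim t)
    then have "\<not> 0 < state_dist P \<mu> d0 t $ s"
      using expected_followon_ge_1[where P=P and \<gamma>=\<gamma> and n=n and \<pi>=\<pi> and \<mu>=\<mu> and ?d0.0=d0 and t=t and s=s, OF \<gamma>]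
      by force
    then show ?case
      using state_dist_nonneg[of P \<mu> d0 t s] by (simp add: inner_axis)
  qed
  then have "(\<lambda>t. state_dist P \<mu> d0 t \<bullet> axis s 1) \<longlonglongrightarrow> 0"
    by (rule tendsto_eventually)
  from stationary_null[OF this] show False
    using stationary_pos[of s] by (simp add: inner_axis)
qed

lemma state_dist_add:
  "state_dist P \<mu> d0 (t + k) = state_dist P \<mu> d0 t v* mat_pow (policy_matrix P \<mu>) k"
  by (induction k) (simp_all add: state_dist_Suc mat_pow_Suc2 vector_matrix_mul_assoc)

lemma emphasis_equation:
  "(\<chi> s. pmf d s * f s) v* mat_pow (discounted_matrix P \<gamma> \<pi>) n + (\<chi> s. pmf d s) = (\<chi> s. pmf d s * f s)"
proof -
  let ?p = "state_dist P \<mu> d0" and ?e = "expected_followon P \<gamma> n \<pi> \<mu> d0"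
    and ?M = "mat_pow (policy_matrix P \<mu>) n" and ?G = "mat_pow (discounted_matrix P \<gamma> \<pi>) n"
  have p_le: "?p t $ s \<le> 1" for t s
    using member_le_sum[of s UNIV "\<lambda>s. ?p t $ s"] state_dist_nonneg[of P \<mu> d0 t] state_dist_sum[of P \<mu> d0 t] by simp
  have null: "(\<lambda>t. ?p t $ s * (f s - ?e t s)) \<longlonglongrightarrow> 0" for s
  proof (rule Lim_null_comparison)
    show "eventually (\<lambda>t. norm (?p t $ s * (f s - ?e t s)) \<le> \<bar>f s - ?e t s\<bar>) sequentially"
      using p_le state_dist_nonneg[of P \<mu> d0] by (auto simp: abs_mult intro!: always_eventually mult_left_le_one_le)
    show "(\<lambda>t. \<bar>f s - ?e t s\<bar>) \<longlonglongrightarrow> 0"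
      using tendsto_rabs[OF tendsto_diff[OF tendsto_const[of "f s"] lim[of s]]] by simp
  qed
  have "(\<Sum>i\<in>UNIV. pmf d i * f i * ?G $ i $ s) + pmf d s = pmf d s * f s" for s
  proof -
    \<comment> \<open>Writing the law at time t + n as p_t M^n makes the residual of the emphasis
      equation at \<open>s\<close> a linear functional of p_t alone; at the stationary law M^n drops
      out again.\<close>
    define l where "l = (\<chi> i. ?M $ i $ s * (f s - 1) - f i * ?G $ i $ s)"
    have inner_l: "q \<bullet> l = (q v* ?M) $ s * (f s - 1) - (\<Sum>i\<in>UNIV. q $ i * f i * ?G $ i $ s)" for q
      by (simp add: l_def inner_vec_def vector_matrix_mult_def right_diff_distrib sum_subtractf sum_distrib_left
          sum_distrib_right mult_ac)
    \<comment> \<open>The recursion cancels everything except the differences between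
      \<open>f\<close> and the conditional expectations.\<close>
    have "?p t \<bullet> l = ?p (t + n) $ s * (f s - ?e (t + n) s) - (\<Sum>i\<in>UNIV. ?p t $ i * (f i - ?e t i) * ?G $ i $ s)" for t
    proof -
      have "?p (t + n) $ s * ?e (t + n) s = (\<Sum>i\<in>UNIV. ?p t $ i * ?e t i * ?G $ i $ s) + ?p (t + n) $ s"
        using arg_cong[OF followon_mass_rec[OF n cov, where P=P and \<gamma>=\<gamma> and ?d0.0=d0 and t=t], where f="\<lambda>v. v $ s"]
        by (simp add: followon_mass_expected vector_matrix_mult_def mult_ac)
      then show ?thesis
        by (simp add: inner_l state_dist_add[symmetric] algebra_simps sum_subtractf)
    qed
    moreover have "(\<lambda>t. ?p (t + n) $ s * (f s - ?e (t + n) s) -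
        (\<Sum>i\<in>UNIV. ?p t $ i * (f i - ?e t i) * ?G $ i $ s)) \<longlonglongrightarrow> 0 - (\<Sum>i\<in>UNIV. 0 * ?G $ i $ s)"
      by (intro tendsto_diff tendsto_sum tendsto_mult_right null LIMSEQ_ignore_initial_segment[OF null])
    ultimately have "(\<chi> s. pmf d s) \<bullet> l = 0"
      by (intro stationary_null) simp
    moreover have "(\<chi> s. pmf d s) v* ?M = (\<chi> s. pmf d s)"
      by (rule stationary_mat_pow[OF stationary_vec(1)])
    ultimately show ?thesis
      by (simp add: inner_l algebra_simps)
  qed
  then show ?thesis
    by (simp add: vec_eq_iff vector_matrix_mult_def mult_ac)
qed

end

section \<open>Choice of the constants and the perturbed problem\<close>

theorem proposition4:
  fixes P :: "'s::finite \<Rightarrow> 'a::finite \<Rightarrow> 's pmf"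
    and r :: "'s \<Rightarrow> 'a \<Rightarrow> real"
    and \<gamma> :: "'s \<Rightarrow> real"
    and n :: nat
    and \<pi> \<mu> :: "'s \<Rightarrow> 'a pmf"
    and d0 d\<^sub>\<mu> :: "'s pmf"
    and f :: "'s \<Rightarrow> real"
    and \<phi> :: "'s \<Rightarrow> real^'k::finite"
  assumes discount: "\<And>s. 0 \<le> \<gamma> s \<and> \<gamma> s \<le> 1"
    and n: "n \<ge> 1"
    and ergodic: "ergodic_chain (policy_matrix P \<mu>)"
    and stationary: "stationary_distribution (policy_matrix P \<mu>) d\<^sub>\<mu>"
    and coverage: "\<And>s a. pmf (\<pi> s) a > 0 \<Longrightarrow> pmf (\<mu> s) a > 0"
    and full_rank: "rank (feature_matrix \<phi>) = CARD('k)"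
    and followon_limit: "\<And>s. (\<lambda>t. expected_followon P \<gamma> n \<pi> \<mu> d0 t s) \<longlonglongrightarrow> f s"
  shows "\<exists>c1>0. \<exists>c2>0. \<exists>c3>0. \<forall>f\<^sub>\<theta> :: 's \<Rightarrow> real.
    (let \<Phi> = feature_matrix \<phi>;
         v = value_fun P r \<gamma> \<pi>;
         D\<^sub>\<theta> = weight_mat d\<^sub>\<mu> f\<^sub>\<theta>;
         D\<^sub>f = weight_mat d\<^sub>\<mu> f;
         D\<^sub>\<epsilon> = D\<^sub>\<theta> - D\<^sub>f;
         A = td_matrix D\<^sub>\<theta> (discounted_matrix P \<gamma> \<pi>) n \<Phi>;
         b = td_vector D\<^sub>\<theta> (nstep_reward P r \<gamma> n \<pi>) \<Phi>;
         w = matrix_inv A *v b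
     in matrix_norm D\<^sub>\<epsilon> \<le> c1 \<longrightarrow>
          invertible A \<and>
          norm (\<Phi> *v w - v) \<le> c2 * matrix_norm D\<^sub>\<epsilon> + c3 * wnorm D\<^sub>f (wproj D\<^sub>f \<Phi> v - v))"
proof -
  define \<Phi> where "\<Phi> = feature_matrix \<phi>"
  define v where "v = value_fun P r \<gamma> \<pi>"
  define H where "H = discounted_matrix P \<gamma> \<pi>"
  define G where "G = mat_pow H n"
  define B where "B = mat 1 - G"
  define x where "x = (\<chi> s. pmf d\<^sub>\<mu> s * f s)"
  define D where "D = weight_mat d\<^sub>\<mu> f"
  have \<gamma>: "0 \<le> \<gamma> s" for s using discount by simp
  have irr: "irreducible_chain (policy_matrix P \<mu>)"
    using ergodic by (simp add: ergodic_chain_def)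
  note ctx = \<gamma> n irr stationary coverage followon_limit
  have d_pos: "0 < pmf d\<^sub>\<mu> s" for s
    by (rule stationary_pos[OF ctx])
  have "0 < f s" for s by (rule less_le_trans[OF zero_less_one emphasis_ge_1[OF ctx]])
  then have x_pos: "0 < x $ s" for s
    using d_pos[of s] by (simp add: x_def)
  have x_eq: "x v* G + (\<chi> s. pmf d\<^sub>\<mu> s) = x"
    unfolding x_def G_def H_def by (rule emphasis_equation[OF ctx])
  have H: "0 \<le> H $ i $ j" for i j
    unfolding H_def by (rule discounted_matrix_nonneg[OF \<gamma>])
  have row: "(\<Sum>j\<in>UNIV. H $ i $ j) \<le> 1" for i
    unfolding H_def by (rule discounted_matrix_substochastic[OF discount])
  have summ: "summable (\<lambda>k. (mat_pow H k *v y) $ s)" if "\<And>s. 0 \<le> y $ s" for y s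
    using emphasis_summable[where x=x and d="\<chi> s. pmf d\<^sub>\<mu> s" and H=H and n=n, OF H x_pos _ x_eq[unfolded G_def] that] d_pos
    by simp
  have Bv: "B *v v = nstep_reward P r \<gamma> n \<pi>"
    unfolding B_def G_def H_def v_def
    by (rule Bellman[OF value_fun_suminf[OF \<gamma> summ[unfolded H_def]]])
  define \<kappa> where "\<kappa> = Min (range (pmf d\<^sub>\<mu>)) / 2"
  have \<kappa>: "0 < \<kappa>" using d_pos by (simp add: \<kappa>_def)
  have D: "D = diag_mat (\<lambda>s. x $ s)"
    by (simp add: D_def weight_mat_def x_def)
  have coercive: "\<kappa> * (norm y)\<^sup>2 \<le> y \<bullet> (D *v (B *v y))" for y
  proof -
    have "\<kappa> * (norm y)\<^sup>2 \<le> (\<Sum>i\<in>UNIV. pmf d\<^sub>\<mu> i * (y $ i)\<^sup>2) / 2"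
      using sum_weighted_squares_ge[of "pmf d\<^sub>\<mu>" y] by (simp add: \<kappa>_def)
    also have "\<dots> \<le> y \<bullet> (D *v (B *v y))"
      using emphasis_coercive[where G=G and x=x and d="\<chi> s. pmf d\<^sub>\<mu> s" and y=y, OF _ _ _ x_eq]
        mat_pow_nonneg[OF H] mat_pow_substochastic[OF H row] less_imp_le[OF x_pos]
      by (simp add: D B_def G_def)
    finally show ?thesis .
  qed
  \<comment> \<open>The price of passing from the Euclidean norm to the norm weighted by
    \<open>D\<close>.\<close>
  define \<xi> where "\<xi> = Min (range (\<lambda>s. x $ s))"
  have \<xi>: "0 < \<xi>" using x_pos by (simp add: \<xi>_def)
  have D_coercive: "\<xi> * (norm y)\<^sup>2 \<le> y \<bullet> (D *v y)" for y
    using sum_weighted_squares_ge[of "\<lambda>s. x $ s" y]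
    by (simp add: \<xi>_def D inner_vec_def power2_eq_square mult_ac)
  have inj: "inj ((*v) \<Phi>)"
    using full_rank by (simp add: \<Phi>_def full_rank_injective)
  \<comment> \<open>The added 1 makes \<beta> visibly positive, so that it may be divided
    by.\<close>
  define \<beta> where "\<beta> = matrix_norm B + 1"
  have \<beta>: "0 < \<beta>" "norm (B *v y) \<le> \<beta> * norm y" for y
    using matrix_norm_nonneg[of B] norm_mat_vec_le[of B y] by (auto simp: \<beta>_def distrib_right add_increasing2)
  \<comment> \<open>Chosen so that \<open>c1 * \<beta>\<close> is \<kappa> / 2: a perturbation of
    this size uses up at most half of the coercivity.\<close>
  define c1 where "c1 = \<kappa> / (2 * \<beta>)"
  have c1: "0 < c1" using \<kappa> \<beta>(1) by (simp add: c1_def)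
  \<comment> \<open>Bounds the norm of \<open>D' ** B\<close> for all admissible \<open>D'\<close>
    at once, which keeps the final constant independent of the trace model.\<close>
  define C where "C = (matrix_norm D + c1) * \<beta>"
  have C: "0 \<le> C" using matrix_norm_nonneg[of D] c1 \<beta>(1) by (simp add: C_def)
  \<comment> \<open>The factor of the Galerkin estimate with the halved coercivity constant, times
    the conversion between the norms.\<close>
  define c3 where "c3 = (1 + C / (\<kappa> / 2)) / sqrt \<xi>"
  have c3: "0 < c3" using C \<kappa> \<xi> by (simp add: c3_def add_pos_nonneg)
  define p where "p = wproj D \<Phi> v"
  have p: "p \<in> col_space \<Phi>"
    unfolding p_def by (rule wproj_in_col_space[OF inj \<xi> D_coercive])
  have norm_p: "norm (p - v) \<le> wnorm D (p - v) / sqrt \<xi>"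
  proof -
    have "sqrt \<xi> * norm (p - v) = sqrt (\<xi> * (norm (p - v))\<^sup>2)"
      by (simp add: real_sqrt_mult)
    also have "\<dots> \<le> wnorm D (p - v)"
      unfolding wnorm_def by (intro real_sqrt_le_mono D_coercive)
    finally show ?thesis using \<xi> by (simp add: pos_le_divide_eq mult.commute)
  qed
  have main: "invertible (td_matrix D' H n \<Phi>) \<and>
      norm (\<Phi> *v (matrix_inv (td_matrix D' H n \<Phi>) *v td_vector D' (nstep_reward P r \<gamma> n \<pi>) \<Phi>) - v)
        \<le> 1 * matrix_norm (D' - D) + c3 * wnorm D (p - v)"
    if small: "matrix_norm (D' - D) \<le> c1" for D'
  proof -
    define E where "E = D' - D"
    have split: "D' *v y = D *v y + E *v y" for y
      by (simp add: E_def matrix_vector_mult_diff_rdistrib)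
    have E: "norm (E *v (B *v y)) \<le> c1 * (\<beta> * norm y)" for y
    proof -
      have "norm (E *v (B *v y)) \<le> matrix_norm E * norm (B *v y)" by (rule norm_mat_vec_le)
      also have "\<dots> \<le> c1 * (\<beta> * norm y)"
        using small c1 by (intro mult_mono \<beta>(2)) (auto simp: E_def)
      finally show ?thesis .
    qed
    let ?K = "D' ** B"
    have K_vec: "?K *v y = D *v (B *v y) + E *v (B *v y)" for y
      by (simp add: matrix_vector_mul_assoc[symmetric] split)
    have K_coercive: "\<kappa> / 2 * (norm y)\<^sup>2 \<le> y \<bullet> (?K *v y)" for y
    proof -
      have "\<bar>y \<bullet> (E *v (B *v y))\<bar> \<le> norm y * (c1 * (\<beta> * norm y))"
        by (rule order_trans[OF Cauchy_Schwarz_ineq2 mult_left_mono[OF E]]) simp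
      also have "\<dots> = \<kappa> / 2 * (norm y)\<^sup>2"
        using \<beta>(1) by (simp add: c1_def power2_eq_square)
      finally show ?thesis
        using coercive[of y] by (simp add: K_vec inner_add_right)
    qed
    have K_bound: "norm (?K *v y) \<le> C * norm y" for y
    proof -
      have "norm (?K *v y) \<le> matrix_norm D * norm (B *v y) + c1 * (\<beta> * norm y)"
        unfolding K_vec by (intro norm_triangle_le add_mono norm_mat_vec_le E)
      also have "matrix_norm D * norm (B *v y) \<le> matrix_norm D * (\<beta> * norm y)"
        by (intro mult_left_mono \<beta>(2) matrix_norm_nonneg)
      finally show ?thesis by (simp add: C_def algebra_simps)
    qed
    have A: "td_matrix D' H n \<Phi> = transpose \<Phi> ** ?K ** \<Phi>"
      by (simp add: td_matrix_def B_def G_def matrix_mul_assoc)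
    \<comment> \<open>The Bellman equation puts the right-hand side in Galerkin form with exact
      solution \<open>v\<close>, for every \<open>D'\<close>.\<close>
    have b: "td_vector D' (nstep_reward P r \<gamma> n \<pi>) \<Phi> = transpose \<Phi> *v (?K *v v)"
      by (simp add: td_vector_def Bv[symmetric] matrix_vector_mul_assoc)
    have \<kappa>2: "0 < \<kappa> / 2" using \<kappa> by simp
    have invA: "invertible (transpose \<Phi> ** ?K ** \<Phi>)"
      by (rule coercive_congruence_invertible[OF inj \<kappa>2 K_coercive])
    have "norm (\<Phi> *v (matrix_inv (transpose \<Phi> ** ?K ** \<Phi>) *v (transpose \<Phi> *v (?K *v v))) - v)
        \<le> (1 + C / (\<kappa> / 2)) * norm (p - v)"
      by (rule Cea[OF \<kappa>2 K_coercive K_bound matrix_inv_vec[OF invA] p])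
    also have "\<dots> \<le> (1 + C / (\<kappa> / 2)) * (wnorm D (p - v) / sqrt \<xi>)"
      using C \<kappa> by (intro mult_left_mono norm_p) simp
    also have "\<dots> \<le> 1 * matrix_norm (D' - D) + c3 * wnorm D (p - v)"
      using matrix_norm_nonneg[of "D' - D"] by (simp add: c3_def)
    finally show ?thesis
      using invA by (simp only: A b simp_thms)
  qed
  show ?thesis
    unfolding Let_def \<Phi>_def[symmetric] v_def[symmetric] H_def[symmetric] D_def[symmetric] p_def[symmetric]
    by (rule exI[of _ c1], rule conjI[OF c1], rule exI[of _ 1], rule conjI[OF zero_less_one],
        rule exI[of _ c3], rule conjI[OF c3], rule allI, rule impI, rule main)
qed

end
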